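(* Let $d\ge1$ be an integer. If $\alpha \ge 0$, then $\mathrm{C}^\infty(\overline{B^d})$ is dense in $\mathrm{WZ}_\alpha(B^d)$.
   Context: $B^d=\{x\in\mathbb{R}^d:|x|<1\}$, $\rho(x)=1-|x|^2$. $\mathrm{L}^2_{w}(B^d)$ is the space of measurable functions with $\|v\|_{\mathrm{L}^2_w(B^d)}^2=\int_{B^d}|v|^2w<\infty$. $\mathrm{WZ}_\alpha(B^d)$ is the Hilbert space of $v\in \mathrm{L}^2_{\rho^\alpha}(B^d)$ whose weak derivatives are such that the following norm is finite: $$\|v\|_{\mathrm{WZ}_\alpha(B^d)} = \Big( \|v\|_{\mathrm{L}^2_{\rho^\alpha}(B^d)}^2 + \|\nabla v\|_{[\mathrm{L}^2_{\rho^{\alpha+1}}(B^d)]^d}^2 + \sum_{1\le i<j\le d} \|x_j \partial_i v - x_i \partial_j v\|_{\mathrm{L}^2_{\rho^\alpha}(B^d)}^2 \Big)^{1/2}.$$ $\mathrm{C}^\infty(\overline{B^d})$ is the space of functions that are smooth up to the boundary on the closed ball. *)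

theory Defs
  imports "HOL-Analysis.Analysis"
begin

text \<open>
  The dimension is \<open>d = CARD('n)\<close>. The linear order on the index type is needed only to
  sum over pairs \<open>i < j\<close>. Functions on the open unit ball are represented by total functions
  on \<open>real ^ 'n\<close> whose values outside the ball are irrelevant. The class constraint
  \<open>{real_normed_field, euclidean_space}\<close> on the codomain covers both real and complex scalars.
\<close>

definition rho :: "real ^ 'n \<Rightarrow> real" where
  "rho x = 1 - (norm x)\<^sup>2"

definition L2w :: "(real ^ 'n \<Rightarrow> real) \<Rightarrow> (real ^ 'n \<Rightarrow> 'a::euclidean_space) set" where
  "L2w w = {v. v \<in> borel_measurable (lebesgue_on (ball 0 1)) \<and>
               integrable (lebesgue_on (ball 0 1)) (\<lambda>x. (norm (v x))\<^sup>2 * w x)}"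

definition L2w_norm :: "(real ^ 'n \<Rightarrow> real) \<Rightarrow> (real ^ 'n \<Rightarrow> 'a::euclidean_space) \<Rightarrow> real" where
  "L2w_norm w v = sqrt (LINT x|lebesgue_on (ball 0 1). (norm (v x))\<^sup>2 * w x)"


definition partial :: "'n \<Rightarrow> (real ^ 'n \<Rightarrow> 'a::euclidean_space) \<Rightarrow> real ^ 'n \<Rightarrow> 'a" where
  "partial i f x = frechet_derivative f (at x) (axis i 1)"

definition iter_partial ::
    "'n list \<Rightarrow> (real ^ 'n \<Rightarrow> 'a::euclidean_space) \<Rightarrow> real ^ 'n \<Rightarrow> 'a" where
  "iter_partial is f = foldr partial is f"

text \<open>
  Differentiability of all iterated partial derivatives makes each of them continuous, so this is
  \<open>C\<^sup>\<infinity>\<close> on the open set \<open>S\<close>.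
\<close>

definition smooth_on :: "(real ^ 'n) set \<Rightarrow> (real ^ 'n \<Rightarrow> 'a::euclidean_space) \<Rightarrow> bool" where
  "smooth_on S f \<longleftrightarrow> (\<forall>is. \<forall>x\<in>S. iter_partial is f differentiable (at x))"

text \<open>
  Smooth up to the boundary: smooth in the open ball, with every partial derivative extending
  continuously to the closed ball.
\<close>

definition C_infinity_cball :: "(real ^ 'n \<Rightarrow> 'a::euclidean_space) set" where
  "C_infinity_cball = {u. continuous_on (cball 0 1) u \<and> smooth_on (ball 0 1) u \<and>
     (\<forall>is. \<exists>g. continuous_on (cball 0 1) g \<and> (\<forall>x\<in>ball 0 1. g x = iter_partial is u x))}"

text \<open>
  Elements of \<open>C\<^sub>c\<^sup>\<infinity>\<close> of the open ball, extended by zero. The support is bounded, hence compact.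
\<close>

definition test_function :: "(real ^ 'n \<Rightarrow> real) \<Rightarrow> bool" where
  "test_function \<phi> \<longleftrightarrow> smooth_on UNIV \<phi> \<and> closure {x. \<phi> x \<noteq> 0} \<subseteq> ball 0 1"

definition locally_integrable :: "(real ^ 'n \<Rightarrow> 'a::euclidean_space) \<Rightarrow> bool" where
  "locally_integrable f \<longleftrightarrow>
     (\<forall>K. compact K \<and> K \<subseteq> ball 0 1 \<longrightarrow> integrable (lebesgue_on K) f)"

definition has_weak_partial ::
    "'n \<Rightarrow> (real ^ 'n \<Rightarrow> 'a::euclidean_space) \<Rightarrow> (real ^ 'n \<Rightarrow> 'a) \<Rightarrow> bool" where
  "has_weak_partial i v g \<longleftrightarrow> locally_integrable v \<and> locally_integrable g \<and>
     (\<forall>\<phi>. test_function \<phi> \<longrightarrow>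
        (LINT x|lebesgue_on (ball 0 1). partial i \<phi> x *\<^sub>R v x) =
        - (LINT x|lebesgue_on (ball 0 1). \<phi> x *\<^sub>R g x))"

text \<open>
  Weak derivatives are unique up to null sets of the ball, and everything below depends on
  them only up to null sets, so an arbitrary representative may be chosen.
\<close>

definition weak_partial :: "'n \<Rightarrow> (real ^ 'n \<Rightarrow> 'a::euclidean_space) \<Rightarrow> real ^ 'n \<Rightarrow> 'a" where
  "weak_partial i v = (SOME g. has_weak_partial i v g)"

definition angular ::
    "'n \<Rightarrow> 'n \<Rightarrow> (real ^ 'n \<Rightarrow> 'a::euclidean_space) \<Rightarrow> real ^ 'n \<Rightarrow> 'a" where
  "angular i j v x = (x $ j) *\<^sub>R weak_partial i v x - (x $ i) *\<^sub>R weak_partial j v x"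

definition WZ :: "real \<Rightarrow> (real ^ 'n::{finite,linorder} \<Rightarrow> 'a::euclidean_space) set" where
  "WZ \<alpha> = {v. v \<in> L2w (\<lambda>x. rho x powr \<alpha>) \<and>
     (\<forall>i. \<exists>g. has_weak_partial i v g) \<and>
     (\<forall>i. weak_partial i v \<in> L2w (\<lambda>x. rho x powr (\<alpha> + 1))) \<and>
     (\<forall>i j. i < j \<longrightarrow> angular i j v \<in> L2w (\<lambda>x. rho x powr \<alpha>))}"

definition WZ_norm ::
    "real \<Rightarrow> (real ^ 'n::{finite,linorder} \<Rightarrow> 'a::euclidean_space) \<Rightarrow> real" where
  "WZ_norm \<alpha> v = sqrt (
     (L2w_norm (\<lambda>x. rho x powr \<alpha>) v)\<^sup>2 +
     (\<Sum>i\<in>UNIV. (L2w_norm (\<lambda>x. rho x powr (\<alpha> + 1)) (weak_partial i v))\<^sup>2) +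
     (\<Sum>(i, j)\<in>{(i, j). i < j}. (L2w_norm (\<lambda>x. rho x powr \<alpha>) (angular i j v))\<^sup>2))"

end

theory Submission
  imports Defs
begin

text \<open>
  Given \<open>v\<close> in the weighted space, dilate and mollify at the same time:
  \<open>u(x) = \<integral> \<psi>((1 - 2 e) x - w) v(w) dw\<close> with \<open>\<psi>\<close> supported in the ball of radius \<open>e\<close>. For \<open>x\<close> in the unit
  ball only points \<open>w\<close> with \<open>|w| \<le> 1 - e\<close> contribute, so \<open>u\<close> is smooth on the whole space. On the
  support of the kernel \<open>rho x \<le> 4 rho w\<close>; because the exponent of the weight is nonnegative, this
  makes the operators bounded on the weighted \<open>L\<^sup>2\<close> spaces uniformly in \<open>e\<close>, hence strongly convergent
  to the identity. The gradient of \<open>u\<close> is the smoothed gradient times \<open>1 - 2 e\<close>. The rotation fields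
  commute with dilations, and their commutator with the mollification is at most
  \<open>e |grad v| \<le> sqrt (e rho) |grad v|\<close>, which tends to \<open>0\<close> because the gradient is square integrable
  against the weight with exponent larger by one.
\<close>

subsection \<open>Smooth bump functions\<close>

text \<open>The obstacle is a mismatch of weights: the gradient is controlled only with exponent
  \<open>\<alpha> + 1\<close>, the rotation fields with \<open>\<alpha>\<close>, so an error made of
  gradients has to win back a factor \<open>rho\<close>. This dictates the dilation. Its margin 2 e
  is twice the mollification radius, which leaves a gap e to the sphere. Hence
  \<open>e \<le> rho w\<close> wherever the kernel lives, a squared coordinate error e^2 is at most
  e \<open>rho w\<close>, and the spare factor e sends the term to 0. The same gap makes the kernel,
  as a function of \<open>w\<close>, a test function, which is what the definition of a weak
  derivative can be applied to.

  Weights compare in one direction only: \<open>x\<close> may approach the sphere while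
  \<open>w\<close> stays away from it, so \<open>rho x\<close> is controlled by \<open>rho w\<close>
  but not conversely.

  Strong convergence is reduced to pairs of points: Jensen's inequality bounds the squared error by
  a kernel average of |f(x) - f(w)|^2, and density of continuous functions makes this small
  uniformly over all mollifiers of small radius.\<close>

lemma partial_eqI:
  assumes "(f has_derivative D) (at x)"
  shows "partial i f x = D (axis i 1)"
  using frechet_derivative_at[OF assms] by (simp add: partial_def)

lemma iter_partial_simps [simp]:
  "iter_partial [] f = f" "iter_partial (i # is) f = partial i (iter_partial is f)"
  by (simp_all add: iter_partial_def)

text \<open>The classical function exp(-1/x) divided by x^k. The division makes the family stable
  under differentiation up to linear combinations.\<close>

definition flat :: "nat \<Rightarrow> real \<Rightarrow> real" where
  "flat k x = (if x > 0 then exp (- 1 / x) / x ^ k else 0)"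

lemma flat_nonneg: "flat k x \<ge> 0"
  by (simp add: flat_def)

lemma flat_pos_iff: "flat k x > 0 \<longleftrightarrow> x > 0"
  by (simp add: flat_def)

lemma flat_0_le_1: "flat 0 x \<le> 1"
  by (simp add: flat_def)

text \<open>The content is at \<open>x = 0\<close>: from the right \<open>flat k h / h\<close> is a
  power of \<open>inverse h\<close> divided by \<open>exp (inverse h)\<close> and tends to 0; from
  the left it is identically 0.\<close>

lemma has_real_derivative_flat:
  "(flat k has_real_derivative flat (k + 2) x - real k * flat (k + 1) x) (at x)"
proof (cases x "0 :: real" rule: linorder_cases)
  case less
  have "((\<lambda>x. 0) has_real_derivative 0) (at x)" by simp
  then have "(flat k has_real_derivative 0) (at x)"
    by (rule has_field_derivative_transform_within_open[of _ _ _ "{..<0}"])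
       (use less in \<open>auto simp: flat_def\<close>)
  with less show ?thesis by (simp add: flat_def)
next
  case equal
  have "((\<lambda>h. inverse h ^ (k + 1) / exp (inverse h)) \<longlongrightarrow> 0) (at_right (0 :: real))"
    by (rule filterlim_compose[OF tendsto_power_div_exp_0 filterlim_inverse_at_top_right])
  then have "((\<lambda>h. flat k h / h) \<longlongrightarrow> 0) (at_right 0)"
  proof (rule Lim_transform_eventually)
    show "\<forall>\<^sub>F h in at_right 0. inverse h ^ (k + 1) / exp (inverse h) = flat k h / h"
      by (auto simp: eventually_at_filter flat_def exp_minus divide_simps)
  qed
  moreover have "((\<lambda>h. flat k h / h) \<longlongrightarrow> 0) (at_left 0)"
  proof (rule Lim_transform_eventually[OF tendsto_const])
    show "\<forall>\<^sub>F h in at_left 0. 0 = flat k h / h"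
      by (auto simp: eventually_at_filter flat_def)
  qed
  ultimately have "((\<lambda>h. flat k h / h) \<longlongrightarrow> 0) (at 0)"
    by (simp add: filterlim_split_at)
  then show ?thesis
    using equal by (simp add: DERIV_def flat_def)
next
  case greater
  have "((\<lambda>x. exp (- 1 / x) / x ^ k) has_real_derivative
      flat (k + 2) x - real k * flat (k + 1) x) (at x)"
  \<comment> \<open>The split keeps the exponent \<open>k - 1\<close> of the power rule away from
    truncated subtraction.\<close>
  proof (cases k)
    case 0
    show ?thesis using greater unfolding flat_def 0
      by (auto intro!: derivative_eq_intros simp: power2_eq_square divide_simps)
  next
    case (Suc m)
    show ?thesis using greater unfolding flat_def Suc
      by (auto intro!: derivative_eq_intros simp: divide_simps)
         (cases m; auto simp: algebra_simps)
  qed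
  then show ?thesis
    by (rule has_field_derivative_transform_within_open[of _ _ _ "{0<..}"])
       (use greater in \<open>auto simp: flat_def\<close>)
qed

text \<open>\<open>smooth_on\<close> quantifies over all iterated partial derivatives. A class of
  differentiable functions closed under \<open>partial\<close> settles all orders by induction on
  the list of indices; constants, sums and products are there because the chain and product rules
  produce them.\<close>

inductive_set bump_algebra :: "(real ^ 'n \<Rightarrow> real) set" where
  const: "(\<lambda>x. c) \<in> bump_algebra"
| flat: "(\<lambda>x. flat k (a * x $ i + b)) \<in> bump_algebra"
| add: "f \<in> bump_algebra \<Longrightarrow> g \<in> bump_algebra \<Longrightarrow> (\<lambda>x. f x + g x) \<in> bump_algebra"
| mult: "f \<in> bump_algebra \<Longrightarrow> g \<in> bump_algebra \<Longrightarrow> (\<lambda>x. f x * g x) \<in> bump_algebra"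

text \<open>Differentiability and closure under derivatives go through one induction, since the
  product rule requires both factors to be differentiable already.\<close>

lemma bump_algebra_has_derivative:
  assumes "f \<in> bump_algebra"
  shows "\<exists>D. (\<forall>x. (f has_derivative D x) (at x)) \<and> (\<forall>j. (\<lambda>x. D x (axis j 1)) \<in> bump_algebra)"
  using assms
proof induction
  case (const c)
  show ?case
    by (rule exI[of _ "\<lambda>x h. 0"]) (simp add: bump_algebra.const)
next
  case (flat k a i b)
  let ?d = "\<lambda>x. flat (k + 2) (a * x $ i + b) + (- real k) * flat (k + 1) (a * x $ i + b)"
  have "((\<lambda>x. flat k (a * x $ i + b)) has_derivative (\<lambda>h. ?d x * (a * h $ i))) (at x)" for x
  proof -
    have "((\<lambda>x. a * x $ i + b) has_derivative (\<lambda>h. a * h $ i)) (at x)"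
      by (auto intro!: derivative_eq_intros
          bounded_linear_imp_has_derivative[OF bounded_linear_vec_nth])
    from has_derivative_compose[OF this
        has_real_derivative_flat[of k "a * x $ i + b", unfolded has_field_derivative_def]]
    show ?thesis by simp
  qed
  moreover have "(\<lambda>x. ?d x * (a * axis j 1 $ i)) \<in> bump_algebra" for j
    by (intro bump_algebra.intros)
  ultimately show ?case
    by (intro exI[of _ "\<lambda>x h. ?d x * (a * h $ i)"]) blast
next
  case (add f g)
  then obtain D E where "\<forall>x. (f has_derivative D x) (at x)" "\<forall>j. (\<lambda>x. D x (axis j 1)) \<in> bump_algebra"
    "\<forall>x. (g has_derivative E x) (at x)" "\<forall>j. (\<lambda>x. E x (axis j 1)) \<in> bump_algebra" by blast
  then show ?case
    by (intro exI[of _ "\<lambda>x h. D x h + E x h"])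
       (auto intro!: derivative_eq_intros bump_algebra.add)
next
  case (mult f g)
  then obtain D E where "\<forall>x. (f has_derivative D x) (at x)" "\<forall>j. (\<lambda>x. D x (axis j 1)) \<in> bump_algebra"
    "\<forall>x. (g has_derivative E x) (at x)" "\<forall>j. (\<lambda>x. E x (axis j 1)) \<in> bump_algebra" by blast
  with mult.hyps show ?case
    by (intro exI[of _ "\<lambda>x h. f x * E x h + D x h * g x"])
       (auto intro!: has_derivative_mult bump_algebra.add bump_algebra.mult)
qed

lemma
  assumes "f \<in> bump_algebra"
  shows bump_algebra_differentiable: "f differentiable (at x)"
    and bump_algebra_partial: "partial j f \<in> bump_algebra"
proof -
  obtain D where D: "\<forall>x. (f has_derivative D x) (at x)" "\<forall>j. (\<lambda>x. D x (axis j 1)) \<in> bump_algebra"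
    using bump_algebra_has_derivative[OF assms] by blast
  then show "f differentiable (at x)" by (auto simp: differentiable_def)
  have "partial j f = (\<lambda>x. D x (axis j 1))"
    using D by (auto intro!: partial_eqI)
  with D show "partial j f \<in> bump_algebra" by simp
qed

lemma bump_algebra_iter_partial: "f \<in> bump_algebra \<Longrightarrow> iter_partial is f \<in> bump_algebra"
  by (induction "is") (auto intro: bump_algebra_partial)

lemma bump_algebra_smooth: "f \<in> bump_algebra \<Longrightarrow> smooth_on S f"
  by (auto simp: smooth_on_def intro: bump_algebra_differentiable bump_algebra_iter_partial)

lemma bump_algebra_prod:
  "finite I \<Longrightarrow> (\<And>i. i \<in> I \<Longrightarrow> f i \<in> bump_algebra) \<Longrightarrow> (\<lambda>x. \<Prod>i\<in>I. f i x) \<in> bump_algebra"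
  by (induction I rule: finite_induct) (auto intro: bump_algebra.intros)

text \<open>Needed with \<open>c = - 1\<close>: the mollifier reflected and translated to
  \<open>w \<mapsto> \<psi> (p - w)\<close> stays in the class and can serve as a test
  function.\<close>

lemma bump_algebra_affine:
  assumes "f \<in> bump_algebra"
  shows "(\<lambda>x. f (c *\<^sub>R x + p)) \<in> bump_algebra"
  using assms
proof induction
  case (flat k a i b)
  have "(\<lambda>x. flat k (a * c * x $ i + (a * p $ i + b))) \<in> bump_algebra"
    by (rule bump_algebra.flat)
  then show ?case by (simp add: algebra_simps)
qed (auto intro: bump_algebra.intros)

lemma bump_algebra_continuous: "f \<in> bump_algebra \<Longrightarrow> continuous_on S f"
  by (meson bump_algebra_differentiable continuous_at_imp_continuous_on differentiable_imp_continuous_within)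

text \<open>\<open>s\<close> is a sharpness parameter: for \<open>s > 0\<close> the zero set does
  not depend on it, and for \<open>s\<close> tending to infinity the indicator of the open box
  appears. With \<open>s = 1\<close> the same function is the raw form of the mollifier.\<close>

definition box_bump :: "real \<Rightarrow> real ^ 'n \<Rightarrow> real ^ 'n \<Rightarrow> real ^ 'n \<Rightarrow> real" where
  "box_bump s a b x = (\<Prod>i\<in>UNIV. flat 0 (s * (x $ i - a $ i)) * flat 0 (s * (b $ i - x $ i)))"

lemma box_bump_in_bump_algebra: "box_bump s a b \<in> bump_algebra"
proof -
  have "(\<lambda>x. \<Prod>i\<in>UNIV. flat 0 (s * x $ i + - s * a $ i) * flat 0 (- s * x $ i + s * b $ i))
      \<in> bump_algebra"
    by (intro bump_algebra_prod bump_algebra.mult bump_algebra.flat) auto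
  then show ?thesis
    by (simp add: box_bump_def[abs_def] algebra_simps)
qed

lemma box_bump_nonneg: "box_bump s a b x \<ge> 0"
  by (auto simp: box_bump_def intro!: prod_nonneg mult_nonneg_nonneg flat_nonneg)

lemma box_bump_le_1: "box_bump s a b x \<le> 1"
  by (auto simp: box_bump_def intro!: prod_le_1 mult_le_one mult_nonneg_nonneg flat_nonneg flat_0_le_1)

lemma box_bump_nonzero_iff:
  assumes "s > 0"
  shows "box_bump s a b x \<noteq> 0 \<longleftrightarrow> x \<in> box a b"
proof -
  have *: "flat 0 y \<noteq> 0 \<longleftrightarrow> y > 0" for y
    using flat_pos_iff[of 0 y] flat_nonneg[of 0 y] by linarith
  show ?thesis
    using assms by (auto simp: box_bump_def mem_box_cart * zero_less_mult_iff)
qed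

text \<open>Inside the box every factor is exp(-1/(s y)) with y > 0 and tends to 1; outside, the
  value is 0 for every n. This carries identities from test functions over to indicators of
  boxes.\<close>

lemma tendsto_box_bump: "(\<lambda>n. box_bump (real (Suc n)) a b x) \<longlonglongrightarrow> indicator (box a b) x"
proof (cases "x \<in> box a b")
  case True
  have *: "(\<lambda>n. flat 0 (real (Suc n) * y)) \<longlonglongrightarrow> 1" if "y > 0" for y
  proof -
    have "(\<lambda>n. exp (- (1 / y) * inverse (real (Suc n)))) \<longlonglongrightarrow> exp (- (1 / y) * 0)"
      by (intro tendsto_intros LIMSEQ_inverse_real_of_nat)
    moreover have "flat 0 (real (Suc n) * y) = exp (- (1 / y) * inverse (real (Suc n)))" for n
      using that by (simp add: flat_def divide_simps)
    ultimately show ?thesis by simp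
  qed
  have "(\<lambda>n. box_bump (real (Suc n)) a b x) \<longlonglongrightarrow> (\<Prod>i\<in>(UNIV :: 'a set). 1 * 1)"
    unfolding box_bump_def using True
    by (intro tendsto_prod tendsto_mult *) (auto simp: mem_box_cart)
  with True show ?thesis by simp
next
  case False
  then have "box_bump (real (Suc n)) a b x = 0" for n
    using box_bump_nonzero_iff[of "real (Suc n)" a b x] by auto
  with False show ?thesis by simp
qed

lemma bump_algebra_test_function:
  assumes "f \<in> bump_algebra" "{x. f x \<noteq> 0} \<subseteq> K" "closed K" "K \<subseteq> ball 0 1"
  shows "test_function f"
  unfolding test_function_def
  using assms closure_minimal[of "{x. f x \<noteq> 0}" K] bump_algebra_smooth[of f] by blast

subsection \<open>Uniqueness of weak derivatives\<close>

text \<open>Proved coordinate by coordinate, with finitely many exceptional null sets. The purpose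
  is to work over \<open>lborel\<close>, where Tonelli's theorem and affine substitutions are
  applied.\<close>

lemma lebesgue_borel_representative:
  fixes f :: "'b::euclidean_space \<Rightarrow> 'a::euclidean_space"
  assumes "f \<in> borel_measurable lebesgue"
  obtains g where "g \<in> borel_measurable borel" "AE x in lborel. f x = g x"
proof -
  have "\<exists>g\<in>borel_measurable lborel. AE x in lborel. f x \<bullet> b = g x" for b
    using assms by (intro completion_ex_borel_measurable_real) auto
  then obtain G where G: "\<And>b. G b \<in> borel_measurable lborel" "\<And>b. AE x in lborel. f x \<bullet> b = G b x"
    by metis
  have "AE x in lborel. \<forall>b\<in>Basis. f x \<bullet> b = G b x"
    using G(2) by (intro AE_finite_allI) auto
  then have "AE x in lborel. f x = (\<Sum>b\<in>Basis. G b x *\<^sub>R b)"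
  proof eventually_elim
    case (elim x)
    then show ?case
      using euclidean_representation[of "f x", symmetric] by simp
  qed
  moreover have "(\<lambda>x. \<Sum>b\<in>Basis. G b x *\<^sub>R b) \<in> borel_measurable borel"
    using G(1) by simp
  ultimately show ?thesis using that by blast
qed

lemma lborel_integral_translation:
  fixes f :: "'b::euclidean_space \<Rightarrow> 'a::euclidean_space"
  assumes "f \<in> borel_measurable borel"
  shows "(LINT x|lborel. f (c + x)) = (LINT x|lborel. f x)"
proof -
  have "(LINT x|lborel. f x) = (LINT x|distr lborel borel ((+) c). f x)"
    by (simp add: lborel_distr_plus)
  also have "\<dots> = (LINT x|lborel. f (c + x))"
    using assms by (intro integral_distr) auto
  finally show ?thesis ..
qed

text \<open>Mean value inequality along the segment in direction \<open>e\<close>. Bounding one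
  directional derivative fits functions of which a single partial derivative is known to be
  continuous.\<close>

lemma norm_diff_le_directional:
  fixes F :: "real ^ 'n \<Rightarrow> 'a::euclidean_space"
  assumes D: "\<And>x. (F has_derivative D x) (at x)" and B: "\<And>x. norm (D x e) \<le> B"
  shows "norm (F (x + h *\<^sub>R e) - F x) \<le> B * \<bar>h\<bar>"
proof -
  have "((\<lambda>s. F (x + s *\<^sub>R e)) has_derivative (\<lambda>s'. s' *\<^sub>R D (x + s *\<^sub>R e) e)) (at s)" for s
  proof -
    have "((\<lambda>s. x + s *\<^sub>R e) has_derivative (\<lambda>s'. s' *\<^sub>R e)) (at s)"
      by (auto intro!: derivative_eq_intros)
    from has_derivative_compose[OF this D] show ?thesis
      by (simp add: linear_simps(5) has_derivative_bounded_linear[OF D])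
  qed
  then have "norm (F (x + h *\<^sub>R e) - F (x + 0 *\<^sub>R e)) \<le> B * norm (h - 0)"
    using B by (intro differentiable_bound[of UNIV "\<lambda>s. F (x + s *\<^sub>R e)"
          "\<lambda>s s'. s' *\<^sub>R D (x + s *\<^sub>R e) e"] onorm_le) (auto simp: mult.commute[of B] intro: mult_left_mono)
  then show ?thesis by simp
qed

text \<open>By translation invariance every difference quotient of \<open>F\<close> has integral \<open>0\<close>.\<close>

lemma integral_directional_derivative_eq_0:
  fixes F :: "real ^ 'n \<Rightarrow> 'a::euclidean_space"
  assumes D: "\<And>x. (F has_derivative D x) (at x)" and B: "\<And>x. norm (D x e) \<le> B"
    and supp: "\<And>x. x \<notin> cball 0 r \<Longrightarrow> F x = 0"
  shows "(\<lambda>x. D x e) \<in> borel_measurable borel" "(LINT x|lborel. D x e) = 0"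
proof -
  define h where "h n = inverse (real (Suc n))" for n
  have h: "h n > 0" "h n \<le> 1" for n by (auto simp: h_def field_simps)
  have hlim: "h \<longlonglongrightarrow> 0" unfolding h_def[abs_def] by (rule LIMSEQ_inverse_real_of_nat)
  define q where "q n x = (F (h n *\<^sub>R e + x) - F x) /\<^sub>R h n" for n x
  have F_cont: "continuous_on UNIV F"
    using D has_derivative_continuous_on by (metis has_derivative_at_withinI)
  have [measurable]: "F \<in> borel_measurable borel"
    using F_cont by (rule borel_measurable_continuous_onI)
  have q_meas [measurable]: "q n \<in> borel_measurable borel" for n
    unfolding q_def[abs_def] by measurable
  have int_F: "integrable lborel F"
  proof -
    have "integrable lborel (\<lambda>x. indicator (cball 0 r) x *\<^sub>R F x)"
      using F_cont by (intro borel_integrable_compact) (auto intro: continuous_on_subset)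
    also have "(\<lambda>x. indicator (cball 0 r) x *\<^sub>R F x) = F"
      using supp by (force simp: indicator_def)
    finally show ?thesis .
  qed
  have int_Fh: "integrable lborel (\<lambda>x. F (c + x))" for c
  proof -
    have "integrable (distr lborel borel ((+) c)) F"
      using int_F by (simp add: lborel_distr_plus)
    then show ?thesis by (subst (asm) integrable_distr_eq) auto
  qed
  have int_q: "(LINT x|lborel. q n x) = 0" for n
    unfolding q_def using int_F int_Fh by (simp add: lborel_integral_translation)
  have q_lim: "(\<lambda>n. q n x) \<longlonglongrightarrow> D x e" for x
  proof -
    have "((\<lambda>s. F (s *\<^sub>R e + x)) has_derivative (\<lambda>s'. s' *\<^sub>R D x e)) (at 0)"
    proof -
      have "((\<lambda>s. s *\<^sub>R e + x) has_derivative (\<lambda>s'. s' *\<^sub>R e)) (at 0)"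
        by (auto intro!: derivative_eq_intros)
      moreover have "(F has_derivative D x) (at (0 *\<^sub>R e + x))" using D[of x] by simp
      ultimately show ?thesis
        using has_derivative_compose[of "\<lambda>s. s *\<^sub>R e + x" "\<lambda>s'. s' *\<^sub>R e" 0 UNIV F "D x"]
        by (simp add: linear_simps(5) has_derivative_bounded_linear[OF D])
    qed
    then have "((\<lambda>s. norm (F (s *\<^sub>R e + x) - F x - s *\<^sub>R D x e) / norm s) \<longlongrightarrow> 0) (at 0)"
      by (simp add: has_derivative_at)
    then have "((\<lambda>s. norm ((F (s *\<^sub>R e + x) - F x) /\<^sub>R s - D x e)) \<longlongrightarrow> 0) (at 0)"
    proof (rule Lim_transform_eventually)
      have "norm (F (s *\<^sub>R e + x) - F x - s *\<^sub>R D x e) / norm s =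
          norm ((F (s *\<^sub>R e + x) - F x) /\<^sub>R s - D x e)" if "s \<noteq> 0" for s
      proof -
        have "(F (s *\<^sub>R e + x) - F x) /\<^sub>R s - D x e = (F (s *\<^sub>R e + x) - F x - s *\<^sub>R D x e) /\<^sub>R s"
          using that by (simp add: scaleR_diff_right)
        then show ?thesis by (simp add: divide_inverse_commute)
      qed
      then show "\<forall>\<^sub>F s in at 0. norm (F (s *\<^sub>R e + x) - F x - s *\<^sub>R D x e) / norm s =
          norm ((F (s *\<^sub>R e + x) - F x) /\<^sub>R s - D x e)"
        by (auto simp: eventually_at_filter)
    qed
    then have "((\<lambda>s. (F (s *\<^sub>R e + x) - F x) /\<^sub>R s) \<longlongrightarrow> D x e) (at 0)"
      using Lim_null tendsto_norm_zero_iff by blast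
    then show ?thesis
      unfolding q_def
      by (rule filterlim_compose) (use h(1)[THEN less_imp_neq, symmetric] hlim in \<open>auto simp: filterlim_at\<close>)
  qed
  show meas: "(\<lambda>x. D x e) \<in> borel_measurable borel"
    by (rule borel_measurable_LIMSEQ_metric[OF q_meas q_lim])
  \<comment> \<open>The step widths are at most 1, so all difference quotients vanish outside one
    ball enlarged by \<open>norm e\<close>; this gives a common integrable majorant.\<close>
  have q_bound: "norm (q n x) \<le> B * indicator (cball 0 (r + norm e)) x" for n x
  proof (cases "x \<in> cball 0 (r + norm e)")
    case True
    have "norm (F (x + h n *\<^sub>R e) - F x) \<le> B * h n"
      using norm_diff_le_directional[OF D B, of x "h n"] h[of n] by simp
    with True h[of n] show ?thesis
      by (simp add: q_def add.commute divide_simps mult.commute)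
  next
    case False
    have "norm (h n *\<^sub>R e) \<le> norm e"
      using h[of n] by (simp add: mult_left_le_one_le)
    then have "norm x - norm e \<le> norm (h n *\<^sub>R e + x)"
      using norm_triangle_ineq2[of x "- (h n *\<^sub>R e)"] by (simp add: add.commute)
    with False have "x \<notin> cball 0 r" "h n *\<^sub>R e + x \<notin> cball 0 r"
      using norm_ge_zero[of e] by (auto simp del: norm_ge_zero)
    then have "F x = 0" "F (h n *\<^sub>R e + x) = 0" using supp by blast+
    then have "q n x = 0" by (simp add: q_def)
    with False show ?thesis by simp
  qed
  have "(\<lambda>n. LINT x|lborel. q n x) \<longlonglongrightarrow> (LINT x|lborel. D x e)"
  proof (rule integral_dominated_convergence)
    show "integrable lborel (\<lambda>x. B * indicator (cball 0 (r + norm e)) x)"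
      using emeasure_bounded_finite[OF bounded_cball[of 0 "r + norm e"]]
      by (intro integrable_mult_right integrable_real_indicator) auto
  qed (use meas q_lim q_bound in auto)
  then show "(LINT x|lborel. D x e) = 0"
    by (simp add: int_q LIMSEQ_const_iff)
qed


text \<open>The Borel sets over which \<open>G\<close> integrates to 0 form a Dynkin system;
  complements are where the vanishing total integral enters. Open boxes are an intersection-stable
  generator of the Borel sets.\<close>

lemma AE_eq_0_if_box_integrals_eq_0:
  fixes G :: "'b::euclidean_space \<Rightarrow> 'a::euclidean_space"
  assumes G: "integrable lborel G" "(LINT x|lborel. G x) = 0"
    and boxes: "\<And>a b. (LINT x:box a b|lborel. G x) = 0"
  shows "AE x in lborel. G x = 0"
proof (rule sigma_finite_measure.density_zero[OF sigma_finite_lborel G(1)])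
  have set_int: "set_integrable lborel A G" if "A \<in> sets borel" for A
    using that G(1) by (auto simp: set_integrable_def intro: integrable_mult_indicator)
  fix A :: "'b set" assume "A \<in> sets lborel"
  then have A: "A \<in> sigma_sets UNIV (range (\<lambda>(a, b). box a b))"
    by (simp add: borel_eq_box)
  have "Int_stable (range (\<lambda>(a, b). box a b :: 'b set))"
    by (auto simp: Int_stable_def box_Int_box)
  moreover have "range (\<lambda>(a, b). box a b :: 'b set) \<subseteq> Pow UNIV" by simp
  ultimately show "(LINT x:A|lborel. G x) = 0"
    using A
  proof (induction rule: sigma_sets_induct_disjoint)
    case (basic A)
    then show ?case using boxes by auto
  next
    case empty
    then show ?case by (simp add: set_lebesgue_integral_def)
  next
    case (compl A)
    then have A: "A \<in> sets borel" by (simp add: borel_eq_box)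
    have "(LINT x:UNIV - A|lborel. G x) = (LINT x|lborel. G x - indicator A x *\<^sub>R G x)"
      unfolding set_lebesgue_integral_def by (rule arg_cong[of _ _ "integral\<^sup>L lborel"]) (auto simp: indicator_def)
    also have "\<dots> = (LINT x|lborel. G x) - (LINT x:A|lborel. G x)"
      using G(1) set_int[OF A] unfolding set_lebesgue_integral_def set_integrable_def
      by (rule Bochner_Integration.integral_diff)
    also have "\<dots> = 0"
      using G(2) compl.IH by simp
    finally show ?case .
  next
    case (union A)
    then have A: "A i \<in> sets borel" for i by (auto simp: borel_eq_box)
    have "(LINT x:(\<Union>i. A i)|lborel. G x) = (\<Sum>i. (LINT x:(A i)|lborel. G x))"
      using A union(1) by (intro lebesgue_integral_countable_add set_int)
        (auto simp: disjoint_family_on_def)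
    then show ?case using union(3) by simp
  qed
qed

section \<open>Test functions and the fundamental lemma of the calculus of variations\<close>

lemma test_function_facts:
  assumes "test_function \<phi>"
  shows "compact (closure {x. \<phi> x \<noteq> 0})" "closure {x. \<phi> x \<noteq> 0} \<subseteq> ball 0 1"
    "\<phi> differentiable (at x)" "partial i \<phi> differentiable (at x)"
    "continuous_on S \<phi>" "continuous_on S (partial i \<phi>)"
    "x \<notin> closure {x. \<phi> x \<noteq> 0} \<Longrightarrow> \<phi> x = 0"
    "x \<notin> closure {x. \<phi> x \<noteq> 0} \<Longrightarrow> partial i \<phi> x = 0"
proof -
  show sub: "closure {x. \<phi> x \<noteq> 0} \<subseteq> ball 0 1"
    using assms by (simp add: test_function_def)
  then show "compact (closure {x. \<phi> x \<noteq> 0})"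
    using bounded_subset[OF bounded_ball] by (simp add: compact_eq_bounded_closed)
  have sm: "iter_partial is \<phi> differentiable (at x)" for "is" x
    using assms by (simp add: test_function_def smooth_on_def)
  show "\<phi> differentiable (at x)" "partial i \<phi> differentiable (at x)"
    using sm[of "[]" x] sm[of "[i]" x] by auto
  show "continuous_on S \<phi>" "continuous_on S (partial i \<phi>)"
    using sm[of "[]", THEN differentiable_imp_continuous_within] sm[of "[i]", THEN differentiable_imp_continuous_within]
    by (auto intro: continuous_at_imp_continuous_on)
  show "\<phi> x = 0" if "x \<notin> closure {x. \<phi> x \<noteq> 0}"
    using that closure_subset[of "{x. \<phi> x \<noteq> 0}"] by auto
  show "partial i \<phi> x = 0" if x: "x \<notin> closure {x. \<phi> x \<noteq> 0}"
  proof -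
    have "(\<phi> has_derivative (\<lambda>h. 0)) (at x)"
    proof (rule has_derivative_transform_within_open)
      show "open (- closure {x. \<phi> x \<noteq> 0})" by (intro open_Compl closed_closure)
      show "x \<in> - closure {x. \<phi> x \<noteq> 0}" using x by simp
      show "0 = \<phi> y" if "y \<in> - closure {x. \<phi> x \<noteq> 0}" for y
        using that closure_subset[of "{x. \<phi> x \<noteq> 0}"] by auto
    qed auto
    then show ?thesis by (rule partial_eqI)
  qed
qed

lemma locally_integrable_compact:
  assumes "locally_integrable g" "compact K" "K \<subseteq> ball 0 1"
  shows "integrable lebesgue (\<lambda>x. indicator K x *\<^sub>R g x)"
  using assms integrable_restrict_space[of K lebesgue g]
  by (auto simp: locally_integrable_def lmeasurable_compact fmeasurableD)

lemma integrable_scaleR_locally_integrable: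
  fixes v :: "real ^ 'n \<Rightarrow> 'a::euclidean_space"
  assumes v: "locally_integrable v" and K: "compact K" "K \<subseteq> ball 0 1"
    and \<psi>: "continuous_on UNIV \<psi>" "\<And>x. x \<notin> K \<Longrightarrow> \<psi> x = 0"
  shows "integrable lebesgue (\<lambda>x. \<psi> x *\<^sub>R v x)"
    and "integrable (lebesgue_on (ball 0 1)) (\<lambda>x. \<psi> x *\<^sub>R v x)"
    and "(LINT x|lebesgue_on (ball 0 1). \<psi> x *\<^sub>R v x) = (LINT x|lebesgue. \<psi> x *\<^sub>R v x)"
proof -
  have eq: "\<psi> x *\<^sub>R v x = \<psi> x *\<^sub>R (indicator K x *\<^sub>R v x)" for x
    using \<psi>(2) by (cases "x \<in> K") auto
  have "bounded (\<psi> ` K)"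
    using K(1) \<psi>(1) by (meson compact_continuous_image compact_imp_bounded continuous_on_subset top_greatest)
  then obtain B where B: "\<And>x. x \<in> K \<Longrightarrow> norm (\<psi> x) \<le> B" by (auto simp: bounded_iff)
  have v_int: "integrable lebesgue (\<lambda>x. indicator K x *\<^sub>R v x)"
    by (rule locally_integrable_compact[OF v K])
  show int: "integrable lebesgue (\<lambda>x. \<psi> x *\<^sub>R v x)"
    unfolding eq
  proof (rule Bochner_Integration.integrable_bound)
    show "integrable lebesgue (\<lambda>x. B *\<^sub>R (indicator K x *\<^sub>R v x))"
      using v_int by (rule integrable_scaleR_right)
    have "\<psi> \<in> borel_measurable lebesgue"
      using borel_measurable_continuous_onI[OF \<psi>(1)] by (simp add: measurable_completion)
    then show "(\<lambda>x. \<psi> x *\<^sub>R (indicator K x *\<^sub>R v x)) \<in> borel_measurable lebesgue"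
      by (rule borel_measurable_scaleR) (rule borel_measurable_integrable[OF v_int])
    show "AE x in lebesgue. norm (\<psi> x *\<^sub>R (indicator K x *\<^sub>R v x))
        \<le> norm (B *\<^sub>R (indicator K x *\<^sub>R v x))"
    proof (intro AE_I2)
      fix x
      show "norm (\<psi> x *\<^sub>R (indicator K x *\<^sub>R v x)) \<le> norm (B *\<^sub>R (indicator K x *\<^sub>R v x))"
        using B[of x] by (cases "x \<in> K") (auto intro!: mult_right_mono)
    qed
  qed
  have ind: "indicator (ball 0 1) x *\<^sub>R (\<psi> x *\<^sub>R v x) = \<psi> x *\<^sub>R v x" for x
    using \<psi>(2)[of x] K(2) by (cases "x \<in> K") (auto simp: indicator_def)
  show "integrable (lebesgue_on (ball 0 1)) (\<lambda>x. \<psi> x *\<^sub>R v x)"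
    "(LINT x|lebesgue_on (ball 0 1). \<psi> x *\<^sub>R v x) = (LINT x|lebesgue. \<psi> x *\<^sub>R v x)"
    using int by (simp_all add: integrable_restrict_space integral_restrict_space ind
        del: scaleR_scaleR)
qed

text \<open>The fundamental lemma of the calculus of variations. Sharpened bumps turn the hypothesis
  into vanishing integrals over boxes with closure in the ball, and a Dynkin argument passes from
  boxes to almost every point.\<close>

lemma locally_integrable_AE_eq_0:
  fixes g :: "real ^ 'n \<Rightarrow> 'a::euclidean_space"
  assumes g: "locally_integrable g"
    and zero: "\<And>\<phi>. test_function \<phi> \<Longrightarrow> (LINT x|lebesgue_on (ball 0 1). \<phi> x *\<^sub>R g x) = 0"
  shows "AE x in lebesgue_on (ball 0 1). g x = 0"
proof -
  have box_zero: "(LINT x|lebesgue. indicator (box a b) x *\<^sub>R g x) = 0"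
    if "cbox a b \<subseteq> ball 0 1" for a b
  proof -
    let ?\<phi> = "\<lambda>n. box_bump (real (Suc n)) a b"
    have supp: "?\<phi> n x = 0" if "x \<notin> cbox a b" for n x
      using that box_bump_nonzero_iff[of "real (Suc n)" a b x] box_subset_cbox[of a b] by auto
    have \<phi>: "test_function (?\<phi> n)" for n
      using that supp by (intro bump_algebra_test_function[of _ "cbox a b"] box_bump_in_bump_algebra) auto
    have cont: "continuous_on UNIV (?\<phi> n)" for n
      by (intro bump_algebra_continuous box_bump_in_bump_algebra)
    note int = integrable_scaleR_locally_integrable[OF g compact_cbox that cont supp]
    have "(LINT x|lebesgue. ?\<phi> n x *\<^sub>R g x) = 0" for n
      using int(3)[of n] zero[OF \<phi>] by simp
    moreover have "(\<lambda>n. LINT x|lebesgue. ?\<phi> n x *\<^sub>R g x) \<longlonglongrightarrow> (LINT x|lebesgue. indicator (box a b) x *\<^sub>R g x)"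
    proof (rule integral_dominated_convergence)
      have g_int: "integrable lebesgue (\<lambda>x. indicator (cbox a b) x *\<^sub>R g x)"
        by (rule locally_integrable_compact[OF g compact_cbox that])
      then show "integrable lebesgue (\<lambda>x. norm (indicator (cbox a b) x *\<^sub>R g x))"
        by (rule integrable_norm)
      show "(\<lambda>x. ?\<phi> n x *\<^sub>R g x) \<in> borel_measurable lebesgue" for n
        using int(1) by (rule borel_measurable_integrable)
      have "(\<lambda>x. indicator (box a b) x *\<^sub>R (indicator (cbox a b) x *\<^sub>R g x)) \<in> borel_measurable lebesgue"
        by (rule borel_measurable_scaleR[OF _ borel_measurable_integrable[OF g_int]])
           (auto intro: borel_measurable_indicator)
      also have "(\<lambda>x. indicator (box a b) x *\<^sub>R (indicator (cbox a b) x *\<^sub>R g x)) = (\<lambda>x. indicator (box a b) x *\<^sub>R g x)"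
        using box_subset_cbox[of a b] by (force simp: indicator_def)
      finally show "(\<lambda>x. indicator (box a b) x *\<^sub>R g x) \<in> borel_measurable lebesgue" .
      show "AE x in lebesgue. (\<lambda>n. ?\<phi> n x *\<^sub>R g x) \<longlonglongrightarrow> indicator (box a b) x *\<^sub>R g x"
        by (intro AE_I2 tendsto_scaleR tendsto_box_bump tendsto_const)
      show "AE x in lebesgue. norm (?\<phi> n x *\<^sub>R g x) \<le> norm (indicator (cbox a b) x *\<^sub>R g x)" for n
      proof (intro AE_I2)
        fix x
        show "norm (?\<phi> n x *\<^sub>R g x) \<le> norm (indicator (cbox a b) x *\<^sub>R g x)"
          using supp[of x n] box_bump_nonneg[of "real (Suc n)" a b x] box_bump_le_1[of "real (Suc n)" a b x]
          by (cases "x \<in> cbox a b") (auto intro: mult_left_le_one_le)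
      qed
    qed
    ultimately show ?thesis by (simp add: LIMSEQ_const_iff)
  qed
  \<comment> \<open>The Dynkin argument needs a globally integrable function, so \<open>g\<close> is
    cut off to one closed box at a time.\<close>
  have cbox_zero: "AE x in lebesgue. x \<in> cbox c d \<longrightarrow> g x = 0" if cd: "cbox c d \<subseteq> ball 0 1" for c d
  proof -
    have f_int: "integrable lebesgue (\<lambda>x. indicator (cbox c d) x *\<^sub>R g x)"
      by (rule locally_integrable_compact[OF g compact_cbox cd])
    then obtain G where G: "G \<in> borel_measurable borel" "AE x in lborel. indicator (cbox c d) x *\<^sub>R g x = G x"
      using lebesgue_borel_representative[OF borel_measurable_integrable] by blast
    \<comment> \<open>Vanishing integrals are known for open boxes, local integrability concerns the
      closed one; the faces between them are negligible.\<close>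
    have bd: "AE x in lebesgue. x \<notin> cbox c d - box c d"
      using negligible_frontier_interval[of c d]
      by (intro AE_not_in) (simp add: negligible_iff_null_sets)
    have ae: "AE x in lebesgue. indicator (box c d) x *\<^sub>R g x = G x"
      using AE_completion[OF G(2)] bd
    proof eventually_elim
      case (elim x)
      then show ?case using box_subset_cbox[of c d] by (auto simp: indicator_def split: if_splits)
    qed
    have "integrable lebesgue G"
      using f_int AE_completion[OF G(2)] G(1)
      by (subst integrable_cong_AE[of _ _ "\<lambda>x. indicator (cbox c d) x *\<^sub>R g x"])
         (auto simp: measurable_completion eq_commute)
    then have G_int: "integrable lborel G"
      using G(1) by (simp add: integrable_completion)
    have ae2: "AE x in lebesgue. indicator (box a b) x *\<^sub>R G x = indicator (box a b \<inter> box c d) x *\<^sub>R g x" for a b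
      using ae by eventually_elim (auto simp: indicator_def)
    have box_G: "(LINT x|lborel. indicator (box a b) x *\<^sub>R G x) = 0" for a b
    proof -
      obtain a' b' where ab': "box a b \<inter> box c d = box a' b'"
        by (simp add: box_Int_box)
      have G_meas: "(\<lambda>x. indicator (box a b) x *\<^sub>R G x) \<in> borel_measurable borel"
        using G(1) by measurable
      then have "(LINT x|lborel. indicator (box a b) x *\<^sub>R G x) = (LINT x|lebesgue. indicator (box a b) x *\<^sub>R G x)"
        by (simp add: integral_completion)
      also have "\<dots> = (LINT x|lebesgue. indicator (box a' b') x *\<^sub>R g x)"
      proof (rule integral_cong_AE)
        show m: "(\<lambda>x. indicator (box a b) x *\<^sub>R G x) \<in> borel_measurable lebesgue"
          using G_meas by (simp add: measurable_completion)
        show "AE x in lebesgue. indicator (box a b) x *\<^sub>R G x = indicator (box a' b') x *\<^sub>R g x"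
          using ae2[of a b] ab' by simp
        then show "(\<lambda>x. indicator (box a' b') x *\<^sub>R g x) \<in> borel_measurable lebesgue"
          by (rule borel_measurable_AE[OF m])
      qed
      also have "\<dots> = 0"
      \<comment> \<open>\<open>box_zero\<close> wants the closed box inside the ball. It is the
        closure of the open box only if that is nonempty: a degenerate \<open>cbox\<close> can be
        nonempty over an empty \<open>box\<close>.\<close>
      proof (cases "box a' b' = {}")
        case False
        have "box a' b' \<subseteq> cbox c d" using ab' box_subset_cbox[of c d] by blast
        then have "cbox a' b' \<subseteq> cbox c d"
          using False by (metis closed_cbox closure_box closure_minimal)
        then show ?thesis using box_zero[of a' b'] cd by auto
      qed simp
      finally show ?thesis .
    qed
    have "(LINT x|lborel. G x) = (LINT x|lborel. indicator (box c d) x *\<^sub>R G x)"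
    proof -
      have "AE x in lborel. G x = indicator (box c d) x *\<^sub>R G x"
        using ae unfolding AE_completion_iff by eventually_elim (auto simp: indicator_def)
      then show ?thesis
        using G(1) by (intro integral_cong_AE) auto
    qed
    then have "AE x in lborel. G x = 0"
      using box_G G_int by (intro AE_eq_0_if_box_integrals_eq_0) (auto simp: set_lebesgue_integral_def)
    then have "AE x in lborel. x \<in> cbox c d \<longrightarrow> g x = 0"
      using G(2) by eventually_elim auto
    then show ?thesis by (rule AE_completion)
  qed
  \<comment> \<open>Countably many closed boxes exhaust the ball, so their null sets can be
    united.\<close>
  obtain \<D> :: "(real ^ 'n) set set" where \<D>: "countable \<D>" "\<And>X. X \<in> \<D> \<Longrightarrow> X \<subseteq> ball 0 1"
     "\<And>X. X \<in> \<D> \<Longrightarrow> \<exists>a b. X = cbox a b" "\<Union>\<D> = ball 0 1"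
    by (rule open_countable_Union_open_cbox[OF open_ball]) blast
  have "AE x in lebesgue. \<forall>X\<in>\<D>. x \<in> X \<longrightarrow> g x = 0"
  proof (rule AE_ball_countable'[OF _ \<D>(1)])
    fix X assume "X \<in> \<D>"
    then obtain a b where "X = cbox a b" "X \<subseteq> ball 0 1" using \<D>(2,3) by blast
    then show "AE x in lebesgue. x \<in> X \<longrightarrow> g x = 0" using cbox_zero by simp
  qed
  then have "AE x in lebesgue. x \<in> ball 0 1 \<longrightarrow> g x = 0"
    by eventually_elim (use \<D>(4) in blast)
  then show ?thesis
    by (simp add: AE_restrict_space_iff)
qed

subsection \<open>Smooth functions belong to the weighted space\<close>

lemma continuous_locally_integrable:
  fixes f :: "real ^ 'n \<Rightarrow> 'a::euclidean_space"
  assumes "continuous_on (ball 0 1) f"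
  shows "locally_integrable f"
  unfolding locally_integrable_def
proof (intro allI impI)
  fix K :: "(real ^ 'n) set" assume K: "compact K \<and> K \<subseteq> ball 0 1"
  then have f: "continuous_on K f" using assms continuous_on_subset by blast
  have "integrable lborel (\<lambda>x. indicator K x *\<^sub>R f x)"
    using K f by (intro borel_integrable_compact) auto
  then have "integrable lebesgue (\<lambda>x. indicator K x *\<^sub>R f x)"
    by (subst integrable_completion) (auto intro: borel_measurable_integrable)
  then show "integrable (lebesgue_on K) f"
    using K by (subst integrable_restrict_space) (auto simp: lmeasurable_compact fmeasurableD)
qed

section \<open>Linearity and uniqueness of weak derivatives, agreement with classical ones\<close>

lemma locally_integrable_diff:
  "locally_integrable f \<Longrightarrow> locally_integrable g \<Longrightarrow> locally_integrable (\<lambda>x. f x - g x)"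
  by (auto simp: locally_integrable_def)

lemma has_weak_partial_diff:
  assumes "has_weak_partial i v g" "has_weak_partial i u h"
  shows "has_weak_partial i (\<lambda>x. v x - u x) (\<lambda>x. g x - h x)"
  unfolding has_weak_partial_def
proof (intro conjI allI impI)
  have loc: "locally_integrable v" "locally_integrable g" "locally_integrable u" "locally_integrable h"
    using assms by (auto simp: has_weak_partial_def)
  then show "locally_integrable (\<lambda>x. v x - u x)" "locally_integrable (\<lambda>x. g x - h x)"
    by (auto intro: locally_integrable_diff)
  fix \<phi> :: "real ^ 'a \<Rightarrow> real" assume \<phi>: "test_function \<phi>"
  note facts = test_function_facts[OF \<phi>]
  have int: "integrable (lebesgue_on (ball 0 1)) (\<lambda>x. \<phi> x *\<^sub>R f x)"
    "integrable (lebesgue_on (ball 0 1)) (\<lambda>x. partial i \<phi> x *\<^sub>R f x)"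
    if "locally_integrable f" for f :: "real ^ 'a \<Rightarrow> 'b"
    using that facts by (intro integrable_scaleR_locally_integrable(2) facts(1,2,5-8); blast)+
  show "(LINT x|lebesgue_on (ball 0 1). partial i \<phi> x *\<^sub>R (v x - u x)) =
      - (LINT x|lebesgue_on (ball 0 1). \<phi> x *\<^sub>R (g x - h x))"
    using assms \<phi> loc int
    by (simp add: scaleR_diff_right has_weak_partial_def)
qed

text \<open>\<open>g - h\<close> is a weak derivative of \<open>v - v\<close>, so all its integrals
  against test functions vanish.\<close>

lemma weak_partial_unique:
  assumes "has_weak_partial i v g" "has_weak_partial i v h"
  shows "AE x in lebesgue_on (ball 0 1). g x = h x"
proof -
  have "has_weak_partial i (\<lambda>x. v x - v x) (\<lambda>x. g x - h x)"
    using assms by (rule has_weak_partial_diff)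
  then have "AE x in lebesgue_on (ball 0 1). g x - h x = 0"
    by (intro locally_integrable_AE_eq_0) (auto simp: has_weak_partial_def)
  then show ?thesis by eventually_elim simp
qed

text \<open>Makes the arbitrary choice in \<open>weak_partial\<close> harmless: once some weak
  derivative exists, the chosen one may be exchanged for any explicit one up to a null set.\<close>

lemma weak_partial_AE_eq:
  assumes "has_weak_partial i v g"
  shows "has_weak_partial i v (weak_partial i v)"
    and "AE x in lebesgue_on (ball 0 1). weak_partial i v x = g x"
proof -
  show "has_weak_partial i v (weak_partial i v)"
    unfolding weak_partial_def using assms by (rule someI[of "has_weak_partial i v"])
  then show "AE x in lebesgue_on (ball 0 1). weak_partial i v x = g x"
    using assms by (rule weak_partial_unique)
qed

text \<open>Integration by parts: \<phi> u has compact support, so the integral of its i-th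
  derivative vanishes by translation invariance, and the product rule splits it into the two desired
  integrals.\<close>

lemma has_weak_partial_partial:
  fixes u :: "real ^ 'n \<Rightarrow> 'a::euclidean_space"
  assumes u: "\<And>x. x \<in> ball 0 1 \<Longrightarrow> u differentiable (at x)"
    and cont_du: "continuous_on (ball 0 1) (partial i u)"
  shows "has_weak_partial i u (partial i u)"
  unfolding has_weak_partial_def
proof (intro conjI allI impI)
  have cont_u: "continuous_on (ball 0 1) u"
    using u by (auto intro!: continuous_at_imp_continuous_on differentiable_imp_continuous_within)
  show loc: "locally_integrable u" "locally_integrable (partial i u)"
    using cont_u cont_du by (auto intro: continuous_locally_integrable)
  fix \<phi> :: "real ^ 'n \<Rightarrow> real" assume \<phi>: "test_function \<phi>"
  note facts = test_function_facts[OF \<phi>]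
  define K where "K = closure {x. \<phi> x \<noteq> 0}"
  note K = facts(1,2,7,8)[folded K_def]
  define F where "F x = \<phi> x *\<^sub>R u x" for x
  \<comment> \<open>Nothing is known about \<open>u\<close> outside the ball, so the product rule is
    used only on \<open>K\<close>. Off \<open>K\<close> the product vanishes on an open set and has
    derivative 0.\<close>
  define D where "D x h = (if x \<in> K then \<phi> x *\<^sub>R frechet_derivative u (at x) h
      + frechet_derivative \<phi> (at x) h *\<^sub>R u x else 0)" for x h
  have F_supp: "F x = 0" if "x \<notin> K" for x using K(3)[OF that] by (simp add: F_def)
  have D: "(F has_derivative D x) (at x)" for x
  proof (cases "x \<in> K")
    case True
    then have "x \<in> ball 0 1" using K(2) by auto
    then have "((\<lambda>x. \<phi> x *\<^sub>R u x) has_derivative (\<lambda>h. \<phi> x *\<^sub>R frechet_derivative u (at x) h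
      + frechet_derivative \<phi> (at x) h *\<^sub>R u x)) (at x)"
      using u facts(3) by (intro has_derivative_scaleR) (auto simp: frechet_derivative_works)
    with True show ?thesis by (simp add: F_def[abs_def] D_def[abs_def])
  next
    case False
    have "(F has_derivative (\<lambda>h. 0)) (at x)"
    proof (rule has_derivative_transform_within_open)
      show "open (- K)" unfolding K_def by (intro open_Compl closed_closure)
    qed (use False F_supp in auto)
    moreover have "D x = (\<lambda>h. 0)" using False by (simp add: D_def[abs_def])
    ultimately show ?thesis by simp
  qed
  have D_eq: "D x (axis i 1) = \<phi> x *\<^sub>R partial i u x + partial i \<phi> x *\<^sub>R u x" for x
    using K(3,4)[of x] by (simp add: D_def partial_def)
  have cont_D: "continuous_on K (\<lambda>x. D x (axis i 1))"
    unfolding D_eq using cont_u cont_du K(2)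
    by (intro continuous_intros facts(5,6)) (auto intro: continuous_on_subset)
  then have "bounded ((\<lambda>x. D x (axis i 1)) ` K)"
    using K(1) by (intro compact_imp_bounded compact_continuous_image)
  then obtain B where "\<And>x. x \<in> K \<Longrightarrow> norm (D x (axis i 1)) \<le> B" by (auto simp: bounded_iff)
  \<comment> \<open>The maximum with 0 provides the bound off \<open>K\<close>, where the derivative
    is 0, and covers an empty \<open>K\<close>, where \<open>B\<close> is arbitrary.\<close>
  then have B: "norm (D x (axis i 1)) \<le> max B 0" for x
    by (cases "x \<in> K") (auto simp: D_def intro: max.coboundedI1)
  have supp: "F x = 0" if "x \<notin> cball 0 1" for x
    using that K(2) ball_subset_cball F_supp by blast
  note I = integral_directional_derivative_eq_0[OF D B supp]
  have int: "integrable lebesgue (\<lambda>x. \<phi> x *\<^sub>R partial i u x)"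
     "integrable lebesgue (\<lambda>x. partial i \<phi> x *\<^sub>R u x)"
    "(LINT x|lebesgue_on (ball 0 1). \<phi> x *\<^sub>R partial i u x) = (LINT x|lebesgue. \<phi> x *\<^sub>R partial i u x)"
    "(LINT x|lebesgue_on (ball 0 1). partial i \<phi> x *\<^sub>R u x) = (LINT x|lebesgue. partial i \<phi> x *\<^sub>R u x)"
    using integrable_scaleR_locally_integrable[OF loc(2) K(1,2) facts(5) K(3)]
      integrable_scaleR_locally_integrable[OF loc(1) K(1,2) facts(6) K(4)] by blast+
  have "0 = (LINT x|lebesgue. D x (axis i 1))"
    using I by (simp add: integral_completion)
  also have "\<dots> = (LINT x|lebesgue. \<phi> x *\<^sub>R partial i u x) + (LINT x|lebesgue. partial i \<phi> x *\<^sub>R u x)"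
    unfolding D_eq using int by simp
  finally show "(LINT x|lebesgue_on (ball 0 1). partial i \<phi> x *\<^sub>R u x) =
      - (LINT x|lebesgue_on (ball 0 1). \<phi> x *\<^sub>R partial i u x)"
    unfolding int by (simp add: eq_neg_iff_add_eq_0 add.commute)
qed

lemma C_infinity_cball_has_weak_partial:
  assumes "u \<in> C_infinity_cball"
  shows "has_weak_partial i u (partial i u)"
proof (rule has_weak_partial_partial)
  have sm: "iter_partial is u differentiable (at x)" if "x \<in> ball 0 1" for "is" x
    using assms that by (auto simp: C_infinity_cball_def smooth_on_def)
  show "u differentiable (at x)" if "x \<in> ball 0 1" for x
    using sm[OF that, of "[]"] by simp
  show "continuous_on (ball 0 1) (partial i u)"
    using sm[of _ "[i]"] by (auto intro!: continuous_at_imp_continuous_on differentiable_imp_continuous_within)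
qed

lemma C_infinity_cball_bounded:
  assumes "u \<in> C_infinity_cball"
  obtains B where "\<And>x. x \<in> ball 0 1 \<Longrightarrow> norm (iter_partial is u x) \<le> B"
proof -
  obtain g where g: "continuous_on (cball 0 1) g" "\<And>x. x \<in> ball 0 1 \<Longrightarrow> g x = iter_partial is u x"
    using assms unfolding C_infinity_cball_def by blast
  have "bounded (g ` cball 0 1)"
    using g(1) by (intro compact_imp_bounded compact_continuous_image) auto
  then obtain B where B: "\<And>x. x \<in> cball 0 1 \<Longrightarrow> norm (g x) \<le> B" unfolding bounded_iff by blast
  show ?thesis
  proof (rule that[of B])
    fix x :: "real ^ 'a" assume "x \<in> ball 0 1"
    then show "norm (iter_partial is u x) \<le> B" using g(2)[of x] B[of x] by simp
  qed
qed

section \<open>The weight and membership in the weighted spaces\<close>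

lemma rho_pos: "x \<in> ball 0 1 \<Longrightarrow> 0 < rho x"
  by (auto simp: rho_def abs_square_less_1 power_less_one_iff)

lemma rho_le_1: "rho x \<le> 1"
  by (simp add: rho_def)

lemma rho_powr_le_1: "\<beta> \<ge> 0 \<Longrightarrow> x \<in> ball 0 1 \<Longrightarrow> rho x powr \<beta> \<le> 1"
  using rho_pos[of x] rho_le_1[of x] powr_mono2[of \<beta> "rho x" 1] by simp

lemma borel_measurable_rho [measurable]: "rho \<in> borel_measurable borel"
  unfolding rho_def[abs_def] by measurable

text \<open>For a nonnegative exponent the weight is at most 1, so the integrand is bounded on a set
  of finite measure.\<close>

lemma bounded_L2w:
  fixes f :: "real ^ 'n \<Rightarrow> 'a::euclidean_space"
  assumes meas: "f \<in> borel_measurable (lebesgue_on (ball 0 1))" and \<beta>: "\<beta> \<ge> 0"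
    and B: "\<And>x. x \<in> ball 0 1 \<Longrightarrow> norm (f x) \<le> B"
  shows "f \<in> L2w (\<lambda>x. rho x powr \<beta>)"
proof -
  have "integrable (lebesgue_on (ball 0 1)) (\<lambda>x. (norm (f x))\<^sup>2 * rho x powr \<beta>)"
  proof (rule measurable_bounded_by_integrable_imp_lebesgue_integrable)
    have "(\<lambda>x. rho x powr \<beta>) \<in> borel_measurable (lebesgue_on (ball (0 :: real ^ 'n) 1))"
      by (intro measurable_restrict_space1 measurable_completion) measurable
    then show "(\<lambda>x. (norm (f x))\<^sup>2 * rho x powr \<beta>) \<in> borel_measurable (lebesgue_on (ball 0 1))"
      using meas by measurable
    have "finite_measure (lebesgue_on (ball (0 :: real ^ 'n) 1))"
      by (rule finite_measure_lebesgue_on) simp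
    then show "integrable (lebesgue_on (ball (0 :: real ^ 'n) 1)) (\<lambda>x. B\<^sup>2)"
      by (rule finite_measure.integrable_const)
    fix x :: "real ^ 'n" assume x: "x \<in> ball 0 1"
    have "(norm (f x))\<^sup>2 * rho x powr \<beta> \<le> B\<^sup>2 * 1"
      using B[OF x] rho_powr_le_1[OF \<beta> x] by (intro mult_mono power_mono) auto
    then show "norm ((norm (f x))\<^sup>2 * rho x powr \<beta>) \<le> B\<^sup>2" by simp
  qed simp
  with meas show ?thesis by (simp add: L2w_def)
qed

lemma borel_measurable_lebesgue_on_AE:
  fixes f g :: "'b::euclidean_space \<Rightarrow> 'a::euclidean_space"
  assumes S: "S \<in> sets lebesgue" and f: "f \<in> borel_measurable (lebesgue_on S)"
    and "AE x in lebesgue_on S. f x = g x"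
  shows "g \<in> borel_measurable (lebesgue_on S)"
proof -
  have "AE x in lebesgue. (if x \<in> S then f x else 0) = (if x \<in> S then g x else 0)"
  proof -
    have "AE x in lebesgue. x \<in> S \<longrightarrow> f x = g x"
      using AE_restrict_space_iff[of S lebesgue "\<lambda>x. f x = g x"] S assms(3) by blast
    then show ?thesis by (rule eventually_mono) simp
  qed
  moreover have "(\<lambda>x. if x \<in> S then f x else 0) \<in> borel_measurable lebesgue"
    using borel_measurable_if[OF S] f by blast
  ultimately have "(\<lambda>x. if x \<in> S then g x else 0) \<in> borel_measurable lebesgue"
    by (rule borel_measurable_AE[rotated])
  then show ?thesis by (rule borel_measurable_if_D)
qed

lemma L2w_AE_cong:
  fixes f g :: "real ^ 'n \<Rightarrow> 'a::euclidean_space"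
  assumes f: "f \<in> L2w (\<lambda>x. rho x powr \<beta>)" and ae: "AE x in lebesgue_on (ball 0 1). f x = g x"
  shows "g \<in> L2w (\<lambda>x. rho x powr \<beta>)"
proof -
  have m: "f \<in> borel_measurable (lebesgue_on (ball 0 1))"
    using f by (simp add: L2w_def)
  then have g: "g \<in> borel_measurable (lebesgue_on (ball 0 1))"
    using ae by (intro borel_measurable_lebesgue_on_AE[of "ball 0 1" f g]) auto
  have [measurable]: "(\<lambda>x. rho x powr \<beta>) \<in> borel_measurable (lebesgue_on (ball (0 :: real ^ 'n) 1))"
    by (intro measurable_restrict_space1 measurable_completion) measurable
  have "integrable (lebesgue_on (ball 0 1)) (\<lambda>x. (norm (f x))\<^sup>2 * rho x powr \<beta>)"
    using f by (simp add: L2w_def)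
  then have "integrable (lebesgue_on (ball 0 1)) (\<lambda>x. (norm (g x))\<^sup>2 * rho x powr \<beta>)"
  proof (rule integrable_cong_AE_imp)
    show "(\<lambda>x. (norm (g x))\<^sup>2 * rho x powr \<beta>) \<in> borel_measurable (lebesgue_on (ball 0 1))"
      using g by measurable
    show "AE x in lebesgue_on (ball 0 1). (norm (f x))\<^sup>2 * rho x powr \<beta> = (norm (g x))\<^sup>2 * rho x powr \<beta>"
      using ae by eventually_elim simp
  qed
  with g show ?thesis by (simp add: L2w_def)
qed

lemma angular_AE_eq:
  assumes "has_weak_partial i v g" "has_weak_partial j v h"
  shows "AE x in lebesgue_on (ball 0 1). angular i j v x = (x $ j) *\<^sub>R g x - (x $ i) *\<^sub>R h x"
  using weak_partial_AE_eq(2)[OF assms(1)] weak_partial_AE_eq(2)[OF assms(2)]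
  by eventually_elim (simp add: angular_def)

text \<open>Continuous extension to the compact closed ball bounds every partial derivative, hence
  also the rotation fields; the chosen weak derivatives agree with the classical ones almost
  everywhere.\<close>

lemma C_infinity_cball_imp_WZ:
  fixes u :: "real ^ 'n::{finite,linorder} \<Rightarrow> 'a::euclidean_space"
  assumes "\<alpha> \<ge> 0" and u: "u \<in> C_infinity_cball"
  shows "u \<in> WZ \<alpha>"
proof -
  have cont: "continuous_on (ball 0 1) (iter_partial is u)" for "is"
    using u by (auto intro!: continuous_at_imp_continuous_on differentiable_imp_continuous_within
        simp: C_infinity_cball_def smooth_on_def)
  then have meas: "iter_partial is u \<in> borel_measurable (lebesgue_on (ball 0 1))" for "is"
    by (rule continuous_imp_measurable_on_sets_lebesgue) simp
  have L2: "iter_partial is u \<in> L2w (\<lambda>x. rho x powr \<beta>)" if "\<beta> \<ge> 0" for "is" \<beta>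
  proof -
    obtain B where "\<And>x. x \<in> ball 0 1 \<Longrightarrow> norm (iter_partial is u x) \<le> B"
      using C_infinity_cball_bounded[OF u] by blast
    with meas that show ?thesis by (rule bounded_L2w)
  qed
  note weak = C_infinity_cball_has_weak_partial[OF u]
  have "weak_partial i u \<in> L2w (\<lambda>x. rho x powr (\<alpha> + 1))" for i
  proof (rule L2w_AE_cong)
    show "partial i u \<in> L2w (\<lambda>x. rho x powr (\<alpha> + 1))"
      using L2[of "\<alpha> + 1" "[i]"] assms by simp
    show "AE x in lebesgue_on (ball 0 1). partial i u x = weak_partial i u x"
      using weak_partial_AE_eq(2)[OF weak[of i]] by eventually_elim simp
  qed
  moreover have "angular i j u \<in> L2w (\<lambda>x. rho x powr \<alpha>)" for i j
  proof (rule L2w_AE_cong)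
    obtain B where B: "\<And>x. x \<in> ball 0 1 \<Longrightarrow> norm (partial i u x) \<le> B"
      using C_infinity_cball_bounded[OF u, of "[i]"] unfolding iter_partial_simps by blast
    obtain C where C: "\<And>x. x \<in> ball 0 1 \<Longrightarrow> norm (partial j u x) \<le> C"
      using C_infinity_cball_bounded[OF u, of "[j]"] unfolding iter_partial_simps by blast
    show "(\<lambda>x. (x $ j) *\<^sub>R partial i u x - (x $ i) *\<^sub>R partial j u x) \<in> L2w (\<lambda>x. rho x powr \<alpha>)"
    proof (rule bounded_L2w[OF _ assms(1)])
      have "(\<lambda>x. x $ k) \<in> borel_measurable (lebesgue_on (ball (0 :: (real, 'n) vec) 1))" for k
        by (intro measurable_restrict_space1 measurable_completion) measurable
      then show "(\<lambda>x. (x $ j) *\<^sub>R partial i u x - (x $ i) *\<^sub>R partial j u x)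
          \<in> borel_measurable (lebesgue_on (ball 0 1))"
        using meas[of "[i]"] meas[of "[j]"] by simp
      fix x :: "(real, 'n) vec" assume x: "x \<in> ball 0 1"
      have c: "\<bar>x $ k\<bar> \<le> 1" for k using component_le_norm_cart[of x k] x by simp
      have "norm ((x $ j) *\<^sub>R partial i u x) \<le> 1 * B" "norm ((x $ i) *\<^sub>R partial j u x) \<le> 1 * C"
        unfolding norm_scaleR using B[OF x] C[OF x] c by (intro mult_mono; simp)+
      then show "norm ((x $ j) *\<^sub>R partial i u x - (x $ i) *\<^sub>R partial j u x) \<le> B + C"
        using norm_triangle_ineq4[of "(x $ j) *\<^sub>R partial i u x" "(x $ i) *\<^sub>R partial j u x"] by linarith
    qed
    show "AE x in lebesgue_on (ball 0 1). (x $ j) *\<^sub>R partial i u x - (x $ i) *\<^sub>R partial j u x = angular i j u x"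
      using angular_AE_eq[OF weak weak, of i j] by eventually_elim simp
  qed
  ultimately show "u \<in> WZ \<alpha>"
    using L2[of \<alpha> "[]"] assms weak[THEN exI[of "has_weak_partial _ u"]] by (auto simp: WZ_def)
qed

subsection \<open>Smoothness of convolutions\<close>

lemma nn_integral_lborel_affine:
  fixes f :: "'b::euclidean_space \<Rightarrow> ennreal"
  assumes [measurable]: "f \<in> borel_measurable borel" and c: "c \<noteq> 0"
  shows "(\<integral>\<^sup>+x. f x \<partial>lborel) = ennreal (\<bar>c\<bar> ^ DIM('b)) * (\<integral>\<^sup>+x. f (p + c *\<^sub>R x) \<partial>lborel)"
  by (subst lborel_affine[OF c, of p])
     (simp add: nn_integral_density nn_integral_distr nn_integral_cmult)

lemma bounded_linear_eq_sum_axis: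
  fixes D :: "real ^ 'n \<Rightarrow> 'a::real_normed_vector"
  assumes "bounded_linear D"
  shows "D h = (\<Sum>i\<in>UNIV. h $ i *\<^sub>R D (axis i 1))"
proof -
  interpret bounded_linear D by fact
  have "D h = D (\<Sum>i\<in>UNIV. h $ i *\<^sub>R axis i 1)"
    using basis_expansion[of h] by (simp add: scalar_mult_eq_scaleR)
  then show ?thesis by (simp add: sum scaleR)
qed

lemma bounded_continuous_compact_support:
  fixes f :: "'b::euclidean_space \<Rightarrow> real"
  assumes "continuous_on UNIV f" "\<And>x. norm x > R \<Longrightarrow> f x = 0"
  obtains B where "B \<ge> 0" "\<And>x. \<bar>f x\<bar> \<le> B"
proof -
  have "bounded (f ` cball 0 R)"
    using assms(1) by (intro compact_imp_bounded compact_continuous_image) (auto intro: continuous_on_subset)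
  then obtain B where B: "\<And>x. x \<in> cball 0 R \<Longrightarrow> norm (f x) \<le> B" unfolding bounded_iff by blast
  show ?thesis
  proof (rule that[of "max B 0"])
    show "\<bar>f x\<bar> \<le> max B 0" for x
      using B[of x] assms(2)[of x] by (cases "norm x > R") auto
  qed simp
qed

lemma partial_support:
  fixes f :: "real ^ 'n \<Rightarrow> 'a::euclidean_space"
  assumes "\<And>x. norm x > R \<Longrightarrow> f x = 0" "norm x > R"
  shows "partial i f x = 0"
proof -
  have "(f has_derivative (\<lambda>h. 0)) (at x)"
  proof (rule has_derivative_transform_within_open)
    show "open {x :: real ^ 'n. norm x > R}"
      by (intro open_Collect_less continuous_intros)
  qed (use assms in auto)
  then show ?thesis by (rule partial_eqI)
qed

text \<open>The convolution of \<open>\<psi>\<close> and \<open>V\<close>, evaluated at c x. As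
  \<open>x\<close> enters through \<open>\<psi>\<close> alone, derivatives fall on the smooth factor
  and \<open>V\<close> has only to be integrable.\<close>

definition dilated_convolution ::
    "real \<Rightarrow> (real ^ 'n \<Rightarrow> real) \<Rightarrow> (real ^ 'n \<Rightarrow> 'a::euclidean_space) \<Rightarrow> real ^ 'n \<Rightarrow> 'a" where
  "dilated_convolution c \<psi> V x = (LINT w|lborel. \<psi> (c *\<^sub>R x - w) *\<^sub>R V w)"

lemma integrable_bounded_scaleR:
  fixes V :: "'b \<Rightarrow> 'a::{banach, second_countable_topology}"
  assumes "integrable M V" "f \<in> borel_measurable M" "\<And>x. \<bar>f x\<bar> \<le> B"
  shows "integrable M (\<lambda>x. f x *\<^sub>R V x)"
proof (rule Bochner_Integration.integrable_bound)
  show "integrable M (\<lambda>x. B *\<^sub>R V x)" using assms(1) by simp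
  show "(\<lambda>x. f x *\<^sub>R V x) \<in> borel_measurable M"
    using assms(2) borel_measurable_integrable[OF assms(1)] by (rule borel_measurable_scaleR)
  have "\<bar>f x\<bar> \<le> \<bar>B\<bar>" for x using assms(3)[of x] by linarith
  then show "AE x in M. norm (f x *\<^sub>R V x) \<le> norm (B *\<^sub>R V x)"
    by (intro AE_I2) (simp add: mult_right_mono)
qed

text \<open>One constant for the derivative and for increments; together they give the majorant for
  differentiation under the integral sign.\<close>

lemma bump_algebra_lipschitz:
  fixes \<psi> :: "real ^ 'n \<Rightarrow> real"
  assumes \<psi>: "\<psi> \<in> bump_algebra" and supp: "\<And>x. norm x > R \<Longrightarrow> \<psi> x = 0"
  obtains L where "\<And>x h. \<bar>frechet_derivative \<psi> (at x) h\<bar> \<le> L * norm h"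
    "\<And>x y. \<bar>\<psi> x - \<psi> y\<bar> \<le> L * norm (x - y)"
proof -
  have D: "(\<psi> has_derivative frechet_derivative \<psi> (at x)) (at x)" for x
    using bump_algebra_differentiable[OF \<psi>] by (simp add: frechet_derivative_works)
  have "\<exists>B\<ge>0. \<forall>x. \<bar>partial i \<psi> x\<bar> \<le> B" for i
  proof -
    have "continuous_on UNIV (partial i \<psi>)"
      by (intro bump_algebra_continuous bump_algebra_partial \<psi>)
    moreover have "partial i \<psi> x = 0" if "norm x > R" for x
      using supp that by (rule partial_support)
    ultimately show ?thesis
      by (rule bounded_continuous_compact_support) auto
  qed
  then have "\<forall>i. \<exists>B. B \<ge> 0 \<and> (\<forall>x. \<bar>partial i \<psi> x\<bar> \<le> B)" by blast
  from choice[OF this] obtain B where B: "\<And>i. B i \<ge> 0" "\<And>i x. \<bar>partial i \<psi> x\<bar> \<le> B i" by blast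
  define L where "L = (\<Sum>i\<in>UNIV. B i)"
  have L: "\<bar>frechet_derivative \<psi> (at x) h\<bar> \<le> L * norm h" for x h
  proof -
    have "\<bar>frechet_derivative \<psi> (at x) h\<bar> = \<bar>\<Sum>i\<in>UNIV. h $ i * partial i \<psi> x\<bar>"
      using bounded_linear_eq_sum_axis[OF has_derivative_bounded_linear[OF D], of x h]
      by (simp add: partial_def)
    also have "\<dots> \<le> (\<Sum>i\<in>UNIV. norm h * B i)"
      unfolding real_norm_def[symmetric]
      by (intro sum_norm_le) (auto simp: abs_mult intro!: mult_mono component_le_norm_cart B)
    finally show ?thesis by (simp add: L_def sum_distrib_left mult.commute)
  qed
  moreover have "\<bar>\<psi> x - \<psi> y\<bar> \<le> L * norm (x - y)" for x y
  proof -
    have "onorm (frechet_derivative \<psi> (at x)) \<le> L" for x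
      using L by (intro onorm_le) simp
    then show ?thesis
      using differentiable_bound[of UNIV \<psi> "\<lambda>x. frechet_derivative \<psi> (at x)" L x y] D by simp
  qed
  ultimately show ?thesis using that by blast
qed

text \<open>Differentiation under the integral sign by dominated convergence. The full derivative is
  established, not just partial ones, because \<open>smooth_on\<close> asks for
  differentiability.\<close>

lemma dilated_convolution_has_derivative:
  fixes V :: "real ^ 'n \<Rightarrow> 'a::euclidean_space"
  assumes \<psi>: "\<psi> \<in> bump_algebra" and supp: "\<And>x. norm x > R \<Longrightarrow> \<psi> x = 0"
    and V: "integrable lborel V"
  shows "(dilated_convolution c \<psi> V has_derivative
      (\<lambda>h. \<Sum>i\<in>UNIV. h $ i *\<^sub>R (c *\<^sub>R dilated_convolution c (partial i \<psi>) V x))) (at x)"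
    (is "(_ has_derivative ?D) _")
proof -
  have D: "(\<psi> has_derivative frechet_derivative \<psi> (at x)) (at x)" for x
    using bump_algebra_differentiable[OF \<psi>] by (simp add: frechet_derivative_works)
  obtain L where L: "\<And>x h. \<bar>frechet_derivative \<psi> (at x) h\<bar> \<le> L * norm h"
    "\<And>x y. \<bar>\<psi> x - \<psi> y\<bar> \<le> L * norm (x - y)"
    using bump_algebra_lipschitz[OF \<psi> supp] by blast
  have int: "integrable lborel (\<lambda>w. \<theta> (y - w) *\<^sub>R V w)"
    if \<theta>: "\<theta> \<in> bump_algebra" "\<And>x. norm x > R \<Longrightarrow> \<theta> x = 0" for \<theta> y
  proof -
    obtain B where "\<And>x. \<bar>\<theta> x\<bar> \<le> B"
      using bounded_continuous_compact_support[OF bump_algebra_continuous[OF \<theta>(1)] \<theta>(2)] by blast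
    moreover have [measurable]: "\<theta> \<in> borel_measurable borel"
      by (intro borel_measurable_continuous_onI bump_algebra_continuous \<theta>)
    ultimately show ?thesis by (intro integrable_bounded_scaleR[OF V]) auto
  qed
  have int_\<psi>: "integrable lborel (\<lambda>w. \<psi> (y - w) *\<^sub>R V w)" for y
    by (rule int[OF \<psi> supp])
  have int_d: "integrable lborel (\<lambda>w. partial i \<psi> (y - w) *\<^sub>R V w)" for i y
    by (rule int[OF bump_algebra_partial[OF \<psi>] partial_support[OF supp]])
  \<comment> \<open>The first-order Taylor remainder of the kernel divided by \<open>norm h\<close>.
    Integrated against \<open>V\<close>, it becomes the remainder quotient of the
    convolution.\<close>
  define r where "r h w = (\<psi> (c *\<^sub>R (x + h) - w) - \<psi> (c *\<^sub>R x - w)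
      - c * frechet_derivative \<psi> (at (c *\<^sub>R x - w)) h) / norm h" for h w
  have fr: "frechet_derivative \<psi> (at y) h = (\<Sum>i\<in>UNIV. h $ i * partial i \<psi> y)" for y h
    using bounded_linear_eq_sum_axis[OF has_derivative_bounded_linear[OF D], of y h]
    by (simp add: partial_def)
  have r_scale: "r h w *\<^sub>R V w = (\<psi> (c *\<^sub>R (x + h) - w) *\<^sub>R V w - \<psi> (c *\<^sub>R x - w) *\<^sub>R V w
      - (\<Sum>i\<in>UNIV. h $ i *\<^sub>R (c *\<^sub>R (partial i \<psi> (c *\<^sub>R x - w) *\<^sub>R V w)))) /\<^sub>R norm h" for h w
  proof -
    have "(\<Sum>i\<in>UNIV. h $ i *\<^sub>R (c *\<^sub>R (partial i \<psi> (c *\<^sub>R x - w) *\<^sub>R V w))) =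
        (c * frechet_derivative \<psi> (at (c *\<^sub>R x - w)) h) *\<^sub>R V w"
      unfolding fr by (simp add: scaleR_sum_left sum_distrib_left mult.left_commute)
    then show ?thesis unfolding r_def by (simp add: scaleR_diff_left scaleR_diff_right right_diff_distrib divide_inverse_commute)
  qed
  have int_r: "integrable lborel (\<lambda>w. r h w *\<^sub>R V w)"
    and r_integral: "(LINT w|lborel. r h w *\<^sub>R V w) =
      (dilated_convolution c \<psi> V (x + h) - dilated_convolution c \<psi> V x - ?D h) /\<^sub>R norm h" for h
    unfolding r_scale dilated_convolution_def by (simp_all add: int_\<psi> int_d del: scaleR_scaleR)
  have "((\<lambda>h. LINT w|lborel. r h w *\<^sub>R V w) \<longlongrightarrow> 0) (at 0)"
    unfolding tendsto_at_iff_sequentially comp_def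
  proof (intro allI impI)
    fix X :: "nat \<Rightarrow> real ^ 'n" assume X: "\<forall>i. X i \<in> UNIV - {0}" "X \<longlonglongrightarrow> 0"
    have "(\<lambda>n. LINT w|lborel. r (X n) w *\<^sub>R V w) \<longlonglongrightarrow> (LINT w|(lborel :: (real ^ 'n) measure). 0 :: 'a)"
    proof (rule integral_dominated_convergence)
      \<comment> \<open>In the majorant, |c| L bounds the increment of \<open>\<psi>\<close> and
        another |c| L the linear term, both per unit of \<open>norm (X n)\<close>.\<close>
      show "integrable lborel (\<lambda>w. norm ((2 * \<bar>c\<bar> * L) *\<^sub>R V w))"
        using V by (intro integrable_norm integrable_scaleR_right) auto
      show "AE w in lborel. (\<lambda>n. r (X n) w *\<^sub>R V w) \<longlonglongrightarrow> 0"
      proof (intro AE_I2)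
        fix w
        have "((\<lambda>y. \<psi> (c *\<^sub>R y - w)) has_derivative (\<lambda>h. frechet_derivative \<psi> (at (c *\<^sub>R x - w)) (c *\<^sub>R h))) (at x)"
          by (rule has_derivative_compose[OF _ D]) (auto intro!: derivative_eq_intros)
        then have "((\<lambda>h. norm (\<psi> (c *\<^sub>R (x + h) - w) - \<psi> (c *\<^sub>R x - w)
            - frechet_derivative \<psi> (at (c *\<^sub>R x - w)) (c *\<^sub>R h)) / norm h) \<longlongrightarrow> 0) (at 0)"
          by (simp add: has_derivative_at)
        moreover have "frechet_derivative \<psi> (at (c *\<^sub>R x - w)) (c *\<^sub>R h) = c * frechet_derivative \<psi> (at (c *\<^sub>R x - w)) h" for h
          using linear_simps(5)[OF has_derivative_bounded_linear[OF D]] by simp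
        ultimately have "((\<lambda>h. norm (r h w)) \<longlongrightarrow> 0) (at 0)"
          by (simp add: r_def)
        then have "((\<lambda>h. r h w) \<longlongrightarrow> 0) (at 0)" by (rule tendsto_norm_zero_cancel)
        then have "(\<lambda>n. r (X n) w) \<longlonglongrightarrow> 0"
          using X unfolding tendsto_at_iff_sequentially comp_def by blast
        then show "(\<lambda>n. r (X n) w *\<^sub>R V w) \<longlonglongrightarrow> 0"
          using tendsto_scaleR[OF _ tendsto_const, of "\<lambda>n. r (X n) w" 0 sequentially "V w"] by simp
      qed
      show "AE w in lborel. norm (r (X n) w *\<^sub>R V w) \<le> norm ((2 * \<bar>c\<bar> * L) *\<^sub>R V w)" for n
      proof (intro AE_I2)
        fix w
        have "\<bar>\<psi> (c *\<^sub>R (x + X n) - w) - \<psi> (c *\<^sub>R x - w)\<bar> \<le> L * norm (c *\<^sub>R X n)"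
          using L(2)[of "c *\<^sub>R (x + X n) - w" "c *\<^sub>R x - w"] by (simp add: algebra_simps)
        moreover have "\<bar>c * frechet_derivative \<psi> (at (c *\<^sub>R x - w)) (X n)\<bar> \<le> \<bar>c\<bar> * (L * norm (X n))"
          unfolding abs_mult by (intro mult_left_mono L) auto
        ultimately have "\<bar>r (X n) w\<bar> \<le> (2 * \<bar>c\<bar> * L * norm (X n)) / norm (X n)"
          unfolding r_def abs_divide abs_norm_cancel by (intro divide_right_mono) (auto simp: algebra_simps)
        also have "\<dots> \<le> \<bar>2 * \<bar>c\<bar> * L\<bar>" using X(1) by simp
        finally show "norm (r (X n) w *\<^sub>R V w) \<le> norm ((2 * \<bar>c\<bar> * L) *\<^sub>R V w)"
          by (simp add: mult_right_mono)
      qed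
    qed (use int_r[THEN borel_measurable_integrable] in simp_all)
    then show "(\<lambda>n. LINT w|lborel. r (X n) w *\<^sub>R V w) \<longlonglongrightarrow> 0" by simp
  qed
  from tendsto_norm[OF this] have "((\<lambda>h. norm (dilated_convolution c \<psi> V (x + h) - dilated_convolution c \<psi> V x - ?D h) / norm h) \<longlongrightarrow> 0) (at 0)"
    unfolding r_integral by (simp add: divide_inverse_commute)
  moreover have "bounded_linear ?D"
    by (intro bounded_linear_sum bounded_linear_scaleR_left[THEN bounded_linear_compose] bounded_linear_vec_nth)
  ultimately show ?thesis by (simp add: has_derivative_at)
qed

lemma partial_dilated_convolution:
  fixes V :: "real ^ 'n \<Rightarrow> 'a::euclidean_space"
  assumes "\<psi> \<in> bump_algebra" "\<And>x. norm x > R \<Longrightarrow> \<psi> x = 0" "integrable lborel V"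
  shows "partial i (dilated_convolution c \<psi> V) x = c *\<^sub>R dilated_convolution c (partial i \<psi>) V x"
proof -
  have "partial i (dilated_convolution c \<psi> V) x =
      (\<Sum>j\<in>UNIV. axis i 1 $ j *\<^sub>R (c *\<^sub>R dilated_convolution c (partial j \<psi>) V x))"
    by (rule partial_eqI[OF dilated_convolution_has_derivative[OF assms]])
  also have "\<dots> = (\<Sum>j\<in>UNIV. if j = i then c *\<^sub>R dilated_convolution c (partial j \<psi>) V x else 0)"
    by (intro sum.cong) (auto simp: axis_def)
  finally show ?thesis by simp
qed

lemma iter_partial_support:
  fixes f :: "real ^ 'n \<Rightarrow> 'a::euclidean_space"
  assumes "\<And>x. norm x > R \<Longrightarrow> f x = 0"
  shows "norm x > R \<Longrightarrow> iter_partial js f x = 0"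
proof (induction js arbitrary: x)
  case (Cons i js)
  show ?case
    using partial_support[OF Cons.IH Cons.prems] by simp
qed (simp add: assms)

lemma partial_scaleR:
  fixes f :: "real ^ 'n \<Rightarrow> 'a::euclidean_space"
  assumes "f differentiable (at x)"
  shows "partial i (\<lambda>x. c *\<^sub>R f x) x = c *\<^sub>R partial i f x"
proof -
  have "((\<lambda>x. c *\<^sub>R f x) has_derivative (\<lambda>h. c *\<^sub>R frechet_derivative f (at x) h)) (at x)"
    using assms by (intro has_derivative_scaleR_right) (simp add: frechet_derivative_works)
  then show ?thesis using partial_eqI by (fastforce simp: partial_def)
qed

lemma iter_partial_dilated_convolution:
  fixes V :: "real ^ 'n \<Rightarrow> 'a::euclidean_space"
  assumes \<psi>: "\<psi> \<in> bump_algebra" and supp: "\<And>x. norm x > R \<Longrightarrow> \<psi> x = 0" and V: "integrable lborel V"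
  shows "iter_partial is (dilated_convolution c \<psi> V) =
    (\<lambda>x. c ^ length is *\<^sub>R dilated_convolution c (iter_partial is \<psi>) V x)"
proof (induction "is")
  case (Cons i "is")
  have "iter_partial is \<psi> x = 0" if "norm x > R" for x
    using supp that by (rule iter_partial_support)
  note a = bump_algebra_iter_partial[OF \<psi>, of "is"] this V
  have "dilated_convolution c (iter_partial is \<psi>) V differentiable (at x)" for x
    using dilated_convolution_has_derivative[OF a] unfolding differentiable_def by blast
  then show ?case
    by (simp add: Cons.IH partial_scaleR partial_dilated_convolution[OF a] mult.commute fun_eq_iff)
qed simp

lemma smooth_dilated_convolution:
  fixes V :: "real ^ 'n \<Rightarrow> 'a::euclidean_space"
  assumes \<psi>: "\<psi> \<in> bump_algebra" and supp: "\<And>x. norm x > R \<Longrightarrow> \<psi> x = 0" and V: "integrable lborel V"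
  shows "smooth_on UNIV (dilated_convolution c \<psi> V)"
  unfolding smooth_on_def
proof (intro allI ballI)
  fix "is" :: "'n list" and x :: "real ^ 'n"
  have supp': "iter_partial is \<psi> x = 0" if "norm x > R" for x
    using supp that by (rule iter_partial_support)
  have "dilated_convolution c (iter_partial is \<psi>) V differentiable (at x)"
    using dilated_convolution_has_derivative[OF bump_algebra_iter_partial[OF \<psi>, of "is"] supp' V]
    unfolding differentiable_def by blast
  then have "(\<lambda>x. c ^ length is *\<^sub>R dilated_convolution c (iter_partial is \<psi>) V x) differentiable (at x)"
    by (intro differentiable_scaleR differentiable_const)
  moreover have "iter_partial is (dilated_convolution c \<psi> V) =
      (\<lambda>x. c ^ length is *\<^sub>R dilated_convolution c (iter_partial is \<psi>) V x)"
    using assms by (rule iter_partial_dilated_convolution)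
  ultimately show "iter_partial is (dilated_convolution c \<psi> V) differentiable (at x)"
    by simp
qed

text \<open>Each partial derivative is continuous on the whole space and thus serves as its own
  extension to the closed ball.\<close>

lemma smooth_on_UNIV_imp_C_infinity_cball:
  assumes "smooth_on UNIV u"
  shows "u \<in> C_infinity_cball"
proof -
  have "continuous_on S (iter_partial is u)" for S "is"
    using assms by (auto simp: smooth_on_def intro!: continuous_at_imp_continuous_on differentiable_imp_continuous_within)
  from this[of _ "[]"] this[of "cball 0 1"] assms show ?thesis
    unfolding C_infinity_cball_def smooth_on_def by auto
qed

subsection \<open>Dilated mollification\<close>

declare borel_open[OF open_ball, measurable] borel_closed[OF closed_cball, measurable]

text \<open>The bound \<open>4 * e \<le> 1\<close> keeps the dilation factor 1 - 2 e above 1/2,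
  which makes all later constants independent of \<open>e\<close>, and is what the comparison of
  \<open>rho x\<close> with \<open>rho w\<close> rests on.\<close>

locale dilation_mollifier =
  fixes e :: real and \<psi> :: "real ^ 'n \<Rightarrow> real"
  assumes e_pos: "0 < e" and e_le: "4 * e \<le> 1"
    and bump: "\<psi> \<in> bump_algebra"
    and nonneg: "\<psi> x \<ge> 0"
    and support: "\<psi> x \<noteq> 0 \<Longrightarrow> norm x < e"
    and total: "(\<integral>\<^sup>+x. ennreal (\<psi> x) \<partial>lborel) = 1"
begin

definition kernel :: "real ^ 'n \<Rightarrow> real ^ 'n \<Rightarrow> real" where
  "kernel x w = \<psi> ((1 - 2 * e) *\<^sub>R x - w)"

end

lemma dilation_mollifier_exists:
  assumes "0 < e" "4 * e \<le> 1"
  shows "\<exists>\<psi> :: real ^ 'n \<Rightarrow> real. dilation_mollifier e \<psi>"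
proof -
  \<comment> \<open>A half-width of \<open>e / CARD('n)\<close> keeps the sum of the absolute
    coordinates, hence the Euclidean norm, below \<open>e\<close>.\<close>
  define c :: "real ^ 'n" where "c = (\<chi> i. e / CARD('n))"
  define \<phi> where "\<phi> = box_bump 1 (- c) c"
  have \<phi>_iff: "\<phi> x \<noteq> 0 \<longleftrightarrow> x \<in> box (- c) c" for x
    unfolding \<phi>_def by (rule box_bump_nonzero_iff) simp
  have \<phi>_bump: "\<phi> \<in> bump_algebra" unfolding \<phi>_def by (rule box_bump_in_bump_algebra)
  have \<phi>_cont: "continuous_on UNIV \<phi>" by (rule bump_algebra_continuous[OF \<phi>_bump])
  have \<phi>_meas: "\<phi> \<in> borel_measurable borel" by (rule borel_measurable_continuous_onI[OF \<phi>_cont])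
  have \<phi>_nonneg: "\<phi> x \<ge> 0" and \<phi>_le: "\<phi> x \<le> 1" for x
    by (simp_all add: \<phi>_def box_bump_nonneg box_bump_le_1)
  have \<phi>_supp: "norm x < e" if "\<phi> x \<noteq> 0" for x
  proof -
    have "norm x \<le> (\<Sum>i\<in>UNIV. \<bar>x $ i\<bar>)" by (rule norm_le_l1_cart)
    also have "\<dots> < (\<Sum>i\<in>(UNIV :: 'n set). e / CARD('n))"
      using that unfolding \<phi>_iff by (intro sum_strict_mono) (auto simp: c_def mem_box_cart abs_less_iff minus_less_iff)
    finally show ?thesis by simp
  qed
  have "(\<integral>\<^sup>+x. ennreal (\<phi> x) \<partial>lborel) \<le> (\<integral>\<^sup>+x. indicator (box (- c) c) x \<partial>lborel)"
  proof (intro nn_integral_mono)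
    fix x show "ennreal (\<phi> x) \<le> indicator (box (- c) c) x"
      using \<phi>_iff[of x] \<phi>_le[of x] by (cases "\<phi> x = 0") auto
  qed
  also have "\<dots> = emeasure lborel (box (- c) c)" by simp
  also have "\<dots> < \<infinity>" by (intro emeasure_bounded_finite bounded_box)
  finally have fin: "(\<integral>\<^sup>+x. ennreal (\<phi> x) \<partial>lborel) < \<infinity>" .
  \<comment> \<open>A vanishing integral would make the closed zero set of full measure, hence the
    whole space, although the bump is nonzero at the origin.\<close>
  have nz: "(\<integral>\<^sup>+x. ennreal (\<phi> x) \<partial>lborel) \<noteq> 0"
  proof
    assume "(\<integral>\<^sup>+x. ennreal (\<phi> x) \<partial>lborel) = 0"
    then have "AE x in lborel. ennreal (\<phi> x) = 0"
      using \<phi>_meas by (subst (asm) nn_integral_0_iff_AE) auto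
    then have "AE x in lborel. x \<in> {x. \<phi> x = 0}"
      using \<phi>_nonneg by (auto elim!: eventually_mono intro: antisym)
    then have "AE x in lebesgue. x \<in> {x. \<phi> x = 0}" by (rule AE_completion)
    moreover have "closed {x. \<phi> x = 0}"
      using \<phi>_cont by (intro closed_Collect_eq) auto
    ultimately have "0 \<in> {x. \<phi> x = 0}"
      by (intro mem_closed_if_AE_lebesgue[where C = "{x. \<phi> x = 0}"])
    then have "0 \<notin> box (- c) c" using \<phi>_iff by blast
    then show False using assms(1) by (simp add: mem_box_cart c_def)
  qed
  define Z where "Z = enn2real (\<integral>\<^sup>+x. ennreal (\<phi> x) \<partial>lborel)"
  have Z: "ennreal Z = (\<integral>\<^sup>+x. ennreal (\<phi> x) \<partial>lborel)" "Z > 0"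
    using fin nz by (auto simp: Z_def enn2real_positive_iff zero_less_iff_neq_zero)
  have "dilation_mollifier e (\<lambda>x. (1 / Z) * \<phi> x)"
  proof
    show "(\<lambda>x. 1 / Z * \<phi> x) \<in> bump_algebra"
      by (intro bump_algebra.mult bump_algebra.const \<phi>_bump)
    have "(\<integral>\<^sup>+x. ennreal (1 / Z * \<phi> x) \<partial>lborel) = (\<integral>\<^sup>+x. ennreal (1 / Z) * ennreal (\<phi> x) \<partial>lborel)"
      using Z(2) \<phi>_nonneg by (intro nn_integral_cong ennreal_mult) auto
    also have "\<dots> = ennreal (1 / Z) * ennreal Z"
      using \<phi>_meas by (simp add: nn_integral_cmult Z(1))
    also have "\<dots> = 1" using Z(2) by (simp flip: ennreal_mult)
    finally show "(\<integral>\<^sup>+x. ennreal (1 / Z * \<phi> x) \<partial>lborel) = 1" .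
  qed (use assms Z(2) \<phi>_nonneg \<phi>_supp in auto)
  then show ?thesis by blast
qed

context dilation_mollifier
begin

lemma continuous_\<psi>: "continuous_on S \<psi>"
  by (rule bump_algebra_continuous[OF bump])

lemma measurable_\<psi> [measurable]: "\<psi> \<in> borel_measurable borel"
  by (rule borel_measurable_continuous_onI[OF continuous_\<psi>])

lemma measurable_kernel [measurable]:
  "(\<lambda>w. kernel x w) \<in> borel_measurable borel"
  "(\<lambda>x. kernel x w) \<in> borel_measurable borel"
  unfolding kernel_def[abs_def] by measurable

lemma kernel_nonneg: "kernel x w \<ge> 0"
  by (simp add: kernel_def nonneg)

text \<open>All four facts follow from |(1 - 2 e) x - w| < e. The factor 4 is 2 times 2:
  \<open>rho x\<close> is at most 2 (1 - |x|), and 1 - |x| is at most 2 (1 - |w|), while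
  \<open>rho w\<close> is at least 1 - |w|. The distance 3 e is the radius e plus the shift 2 e
  |x|.\<close>

lemma
  assumes x: "x \<in> ball 0 1" and k: "kernel x w \<noteq> 0"
  shows kernel_support: "w \<in> cball 0 (1 - e)"
    and kernel_rho_ge: "e \<le> rho w"
    and kernel_rho_le: "rho x \<le> 4 * rho w"
    and kernel_dist: "dist x w \<le> 3 * e"
proof -
  have close: "norm ((1 - 2 * e) *\<^sub>R x - w) < e"
    using k support by (simp add: kernel_def)
  have x1: "norm x < 1" using x by simp
  have "norm w \<le> norm ((1 - 2 * e) *\<^sub>R x) + norm ((1 - 2 * e) *\<^sub>R x - w)"
    by (metis add.commute norm_minus_commute norm_triangle_sub)
  also have "norm ((1 - 2 * e) *\<^sub>R x) = (1 - 2 * e) * norm x"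
    using e_le e_pos by simp
  finally have w: "norm w \<le> (1 - 2 * e) * norm x + e" using close by simp
  have "(1 - 2 * e) * norm x \<le> (1 - 2 * e) * 1"
    using x1 e_le e_pos by (intro mult_left_mono) auto
  with w have w1: "norm w \<le> 1 - e" by simp
  then show "w \<in> cball 0 (1 - e)" by simp
  have rho_ge: "1 - norm w \<le> rho w"
    using w1 e_pos by (simp add: rho_def power2_eq_square mult_left_le)
  then show "e \<le> rho w" using w1 by simp
  \<comment> \<open>The target 1 - |w| \<ge> (1 - |x|) / 2 amounts, after inserting the bound for
    |w|, to (1/2 - 2 e) |x| \<le> 1/2 - e; here \<open>4 * e \<le> 1\<close> gives the sign of the
    coefficient.\<close>
  have "(1 / 2 - 2 * e) * norm x \<le> (1 / 2 - 2 * e) * 1"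
    using x1 e_le by (intro mult_left_mono) auto
  then have "norm x / 2 - 2 * (e * norm x) \<le> 1 / 2 - 2 * e" by (simp add: algebra_simps)
  moreover have "norm w \<le> norm x - 2 * (e * norm x) + e" using w by (simp add: algebra_simps)
  ultimately have "(1 - norm x) / 2 \<le> 1 - norm w" using e_pos by (simp add: field_simps)
  moreover have "rho x \<le> 2 * (1 - norm x)"
    using sum_squares_ge_zero[of "1 - norm x" 0] by (simp add: rho_def power2_eq_square algebra_simps)
  ultimately show "rho x \<le> 4 * rho w" using rho_ge by linarith
  have "x - w = ((1 - 2 * e) *\<^sub>R x - w) + (2 * e) *\<^sub>R x" by (simp add: algebra_simps)
  then have "dist x w \<le> norm ((1 - 2 * e) *\<^sub>R x - w) + norm ((2 * e) *\<^sub>R x)"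
    unfolding dist_norm by (metis norm_triangle_ineq)
  also have "norm ((2 * e) *\<^sub>R x) \<le> 2 * e"
    using x1 e_pos by simp
  finally show "dist x w \<le> 3 * e" using close by simp
qed

lemma kernel_in_ball: "x \<in> ball 0 1 \<Longrightarrow> kernel x w \<noteq> 0 \<Longrightarrow> w \<in> ball 0 1"
  using kernel_support[of x w] e_pos by auto

section \<open>Weighted bounds for the kernel operator\<close>

lemma nn_integral_kernel: "(\<integral>\<^sup>+w. ennreal (kernel x w) \<partial>lborel) = 1"
  using nn_integral_lborel_affine[of "\<lambda>y. ennreal (\<psi> y)" "- 1" "(1 - 2 * e) *\<^sub>R x"] total
  by (simp add: kernel_def)

text \<open>In the variable \<open>x\<close> the dilation spoils the normalisation: the mass is (1 -
  2 e)^(-d) by substitution, and 1 - 2 e is at least 1/2.\<close>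

lemma nn_integral_kernel_left: "(\<integral>\<^sup>+x. ennreal (kernel x w) \<partial>lborel) \<le> ennreal (2 ^ DIM(real ^ 'n))"
proof -
  let ?d = "DIM(real ^ 'n)" and ?t = "1 - 2 * e"
  let ?I = "\<integral>\<^sup>+x. ennreal (kernel x w) \<partial>lborel"
  have t: "1 / 2 \<le> ?t" using e_le by simp
  have 1: "ennreal (?t ^ ?d) * ?I = 1"
    using nn_integral_lborel_affine[of "\<lambda>y. ennreal (\<psi> y)" ?t "- w"] total t by (simp add: kernel_def)
  have "?I = ennreal (2 ^ ?d * (1 / 2) ^ ?d) * ?I"
    by (simp flip: power_mult_distrib)
  also have "\<dots> \<le> ennreal (2 ^ ?d * ?t ^ ?d) * ?I"
    using t by (intro mult_right_mono ennreal_leI mult_left_mono power_mono) auto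
  also have "\<dots> = ennreal (2 ^ ?d) * (ennreal (?t ^ ?d) * ?I)"
    using t by (subst ennreal_mult) (auto simp: mult.assoc)
  finally show ?thesis unfolding 1 by simp
qed

text \<open>A Schur-type estimate: the weight is moved from \<open>x\<close> to \<open>w\<close> at
  the cost of \<open>4 powr \<beta>\<close>, where the sign of \<open>\<beta>\<close> matters, then
  Tonelli's theorem leaves the mass of the kernel in \<open>x\<close>.\<close>

lemma nn_integral_kernel_bound:
  fixes F :: "real ^ 'n \<Rightarrow> ennreal"
  assumes [measurable]: "F \<in> borel_measurable borel" and \<beta>: "\<beta> \<ge> 0"
  shows "(\<integral>\<^sup>+x\<in>ball 0 1. (\<integral>\<^sup>+w. ennreal (kernel x w) * F w \<partial>lborel) * ennreal (rho x powr \<beta>) \<partial>lborel)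
    \<le> ennreal (2 ^ DIM(real ^ 'n) * 4 powr \<beta>) * (\<integral>\<^sup>+w\<in>ball 0 1. F w * ennreal (rho w powr \<beta>) \<partial>lborel)"
proof -
  let ?b = "ball (0 :: real ^ 'n) 1"
  define G where "G w = ennreal (4 powr \<beta>) * (F w * ennreal (rho w powr \<beta>) * indicator ?b w)" for w
  have G_meas [measurable]: "G \<in> borel_measurable borel"
    unfolding G_def by measurable
  have m: "(\<lambda>p. ennreal (\<psi> ((1 - 2 * e) *\<^sub>R snd p - fst p)) * G (fst p))
      \<in> borel_measurable (lborel \<Otimes>\<^sub>M lborel)"
    by measurable
  have le: "ennreal (kernel x w) * F w * ennreal (rho x powr \<beta>) * indicator ?b x \<le> ennreal (kernel x w) * G w" for x w
  proof (cases "x \<in> ?b \<and> kernel x w \<noteq> 0")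
    case True
    then have w: "w \<in> ?b" using kernel_in_ball by blast
    have "rho x powr \<beta> \<le> (4 * rho w) powr \<beta>"
      using True rho_pos[of x] \<beta> kernel_rho_le[of x w] by (intro powr_mono2) auto
    also have "\<dots> = 4 powr \<beta> * rho w powr \<beta>"
      using rho_pos[OF w] by (simp add: powr_mult)
    finally have "ennreal (rho x powr \<beta>) \<le> ennreal (4 powr \<beta> * rho w powr \<beta>)"
      by (rule ennreal_leI)
    also have "\<dots> = ennreal (4 powr \<beta>) * ennreal (rho w powr \<beta>)"
      by (rule ennreal_mult) simp_all
    finally have "ennreal (rho x powr \<beta>) \<le> ennreal (4 powr \<beta>) * ennreal (rho w powr \<beta>)" .
    then have "ennreal (kernel x w) * F w * ennreal (rho x powr \<beta>)
        \<le> ennreal (kernel x w) * F w * (ennreal (4 powr \<beta>) * ennreal (rho w powr \<beta>))"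
      by (rule mult_left_mono) simp
    then show ?thesis using True w by (simp add: G_def mult_ac)
  qed auto
  have "(\<integral>\<^sup>+x\<in>?b. (\<integral>\<^sup>+w. ennreal (kernel x w) * F w \<partial>lborel) * ennreal (rho x powr \<beta>) \<partial>lborel)
      = (\<integral>\<^sup>+x. \<integral>\<^sup>+w. ennreal (kernel x w) * F w * ennreal (rho x powr \<beta>) * indicator ?b x \<partial>lborel \<partial>lborel)"
    by (intro nn_integral_cong) (simp add: nn_integral_multc)
  also have "\<dots> \<le> (\<integral>\<^sup>+x. \<integral>\<^sup>+w. ennreal (kernel x w) * G w \<partial>lborel \<partial>lborel)"
    by (intro nn_integral_mono le)
  also have "\<dots> = (\<integral>\<^sup>+w. \<integral>\<^sup>+x. ennreal (kernel x w) * G w \<partial>lborel \<partial>lborel)"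
    using m unfolding kernel_def
    by (intro lborel_pair.Fubini'[where f = "\<lambda>w x. ennreal (\<psi> ((1 - 2 * e) *\<^sub>R x - w)) * G w"])
       (simp only: split_beta')
  also have "\<dots> = (\<integral>\<^sup>+w. (\<integral>\<^sup>+x. ennreal (kernel x w) \<partial>lborel) * G w \<partial>lborel)"
    by (intro nn_integral_cong nn_integral_multc) measurable
  also have "\<dots> \<le> (\<integral>\<^sup>+w. ennreal (2 ^ DIM(real ^ 'n)) * G w \<partial>lborel)"
    by (intro nn_integral_mono mult_right_mono nn_integral_kernel_left) simp
  also have "\<dots> = ennreal (2 ^ DIM(real ^ 'n) * 4 powr \<beta>) * (\<integral>\<^sup>+w\<in>?b. F w * ennreal (rho w powr \<beta>) \<partial>lborel)"
    unfolding G_def by (simp add: nn_integral_cmult ennreal_mult mult.assoc)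
  finally show ?thesis .
qed

text \<open>Jensen's inequality for the probability density \<open>kernel x\<close>, obtained from
  Cauchy-Schwarz by splitting the kernel into two square roots.\<close>

lemma kernel_jensen:
  fixes H :: "real ^ 'n \<Rightarrow> 'a::euclidean_space"
  assumes [measurable]: "H \<in> borel_measurable borel"
  shows "ennreal ((norm (LINT w|lborel. kernel x w *\<^sub>R H w))\<^sup>2)
    \<le> (\<integral>\<^sup>+w. ennreal (kernel x w) * ennreal ((norm (H w))\<^sup>2) \<partial>lborel)"
proof (cases "integrable lborel (\<lambda>w. kernel x w *\<^sub>R H w)")
  case True
  have "ennreal (norm (LINT w|lborel. kernel x w *\<^sub>R H w)) \<le> (\<integral>\<^sup>+w. ennreal (norm (kernel x w *\<^sub>R H w)) \<partial>lborel)"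
    using True by (rule integral_norm_bound_ennreal)
  also have "\<dots> = (\<integral>\<^sup>+w. ennreal (sqrt (kernel x w)) * ennreal (sqrt (kernel x w) * norm (H w)) \<partial>lborel)"
    using kernel_nonneg by (intro nn_integral_cong) (simp flip: ennreal_mult mult.assoc)
  finally have "(ennreal (norm (LINT w|lborel. kernel x w *\<^sub>R H w)))\<^sup>2 \<le>
     (\<integral>\<^sup>+w. ennreal (sqrt (kernel x w)) * ennreal (sqrt (kernel x w) * norm (H w)) \<partial>lborel)\<^sup>2"
    by (rule power_mono) simp
  also have "\<dots> \<le> (\<integral>\<^sup>+w. (ennreal (sqrt (kernel x w)))\<^sup>2 \<partial>lborel) * (\<integral>\<^sup>+w. (ennreal (sqrt (kernel x w) * norm (H w)))\<^sup>2 \<partial>lborel)"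
    by (rule Cauchy_Schwarz_nn_integral) measurable
  also have "(\<integral>\<^sup>+w. (ennreal (sqrt (kernel x w)))\<^sup>2 \<partial>lborel) = 1"
    using kernel_nonneg nn_integral_kernel by (simp add: ennreal_power)
  also have "(\<integral>\<^sup>+w. (ennreal (sqrt (kernel x w) * norm (H w)))\<^sup>2 \<partial>lborel)
      = (\<integral>\<^sup>+w. ennreal (kernel x w) * ennreal ((norm (H w))\<^sup>2) \<partial>lborel)"
    using kernel_nonneg by (intro nn_integral_cong) (simp add: ennreal_power power_mult_distrib ennreal_mult)
  finally show ?thesis by (simp add: ennreal_power)
next
  \<comment> \<open>The Bochner integral of a function that is not integrable is 0 by convention, so
    the left side vanishes.\<close>
  case False
  then show ?thesis by (simp add: not_integrable_integral_eq)
qed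

lemma
  shows integrable_kernel: "integrable lborel (\<lambda>w. kernel x w *\<^sub>R (c :: 'a::euclidean_space))"
    and integral_kernel: "(LINT w|lborel. kernel x w *\<^sub>R c) = c"
proof -
  have hb: "has_bochner_integral lborel (\<lambda>w. kernel x w) 1"
    using kernel_nonneg nn_integral_kernel by (intro has_bochner_integral_nn_integral) auto
  then show "integrable lborel (\<lambda>w. kernel x w *\<^sub>R c)" "(LINT w|lborel. kernel x w *\<^sub>R c) = c"
    by (simp_all add: has_bochner_integral_iff)
qed

text \<open>The cut-off makes the convolved function integrable; it is invisible to the kernel at points
  of the ball.\<close>

definition smoothing :: "(real ^ 'n \<Rightarrow> 'a::euclidean_space) \<Rightarrow> real ^ 'n \<Rightarrow> 'a" where
  "smoothing f = dilated_convolution (1 - 2 * e) \<psi> (\<lambda>w. indicator (cball 0 (1 - e)) w *\<^sub>R f w)"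

context
  fixes f :: "real ^ 'n \<Rightarrow> 'a::euclidean_space"
  assumes int_f: "integrable lborel (\<lambda>w. indicator (cball 0 (1 - e)) w *\<^sub>R f w)"
begin

lemma smoothing_C_infinity: "smoothing f \<in> C_infinity_cball"
proof -
  have "\<psi> x = 0" if "norm x > e" for x using that support[of x] by linarith
  then have "smooth_on UNIV (smoothing f)"
    unfolding smoothing_def using bump int_f by (intro smooth_dilated_convolution[of \<psi> e])
  then show "smoothing f \<in> C_infinity_cball" by (rule smooth_on_UNIV_imp_C_infinity_cball)
qed

lemma
  assumes x: "x \<in> ball 0 1"
  shows smoothing_eq: "smoothing f x = (LINT w|lborel. kernel x w *\<^sub>R f w)"
    and integrable_kernel_scaleR: "integrable lborel (\<lambda>w. kernel x w *\<^sub>R f w)"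
proof -
  have eq: "kernel x w *\<^sub>R (indicator (cball 0 (1 - e)) w *\<^sub>R f w) = kernel x w *\<^sub>R f w" for w
    using kernel_support[OF x, of w] by (cases "kernel x w = 0") auto
  show "smoothing f x = (LINT w|lborel. kernel x w *\<^sub>R f w)"
    unfolding smoothing_def dilated_convolution_def kernel_def[symmetric] eq ..
  have "\<psi> x = 0" if "norm x > e" for x using that support[of x] by linarith
  then obtain B where "\<And>x. \<bar>\<psi> x\<bar> \<le> B"
    using bounded_continuous_compact_support[OF continuous_\<psi>] by blast
  then have "integrable lborel (\<lambda>w. kernel x w *\<^sub>R (indicator (cball 0 (1 - e)) w *\<^sub>R f w))"
    by (intro integrable_bounded_scaleR[OF int_f, of _ B]) (auto simp: kernel_def)
  then show "integrable lborel (\<lambda>w. kernel x w *\<^sub>R f w)" unfolding eq .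
qed

end

end

subsection \<open>Continuity in weighted mean\<close>

text \<open>The squared weighted norm as an extended nonnegative integral: a divergent integral
  counts as infinite, not as 0 as in \<open>L2w_norm\<close>, so estimates can precede any proof of
  integrability.\<close>

definition L2sq :: "real \<Rightarrow> (real ^ 'n \<Rightarrow> 'a::euclidean_space) \<Rightarrow> ennreal" where
  "L2sq \<beta> f = (\<integral>\<^sup>+x\<in>ball 0 1. ennreal ((norm (f x))\<^sup>2) * ennreal (rho x powr \<beta>) \<partial>lborel)"

lemma norm_add_sq_le: "(norm (a + b))\<^sup>2 \<le> 2 * (norm a)\<^sup>2 + 2 * (norm b)\<^sup>2"
proof -
  have "(norm (a + b))\<^sup>2 \<le> (norm a + norm b)\<^sup>2"
    by (intro power_mono norm_triangle_ineq) simp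
  also have "\<dots> \<le> 2 * (norm a)\<^sup>2 + 2 * (norm b)\<^sup>2"
    using sum_squares_ge_zero[of "norm a - norm b" 0] by (simp add: power2_eq_square algebra_simps)
  finally show ?thesis .
qed

lemma ennreal_norm_add_sq_le:
  "ennreal ((norm (a + b))\<^sup>2) \<le> 2 * ennreal ((norm a)\<^sup>2) + 2 * ennreal ((norm b)\<^sup>2)"
proof -
  have "ennreal ((norm (a + b))\<^sup>2) \<le> ennreal (2 * (norm a)\<^sup>2 + 2 * (norm b)\<^sup>2)"
    by (intro ennreal_leI norm_add_sq_le)
  then show ?thesis by (simp add: ennreal_mult)
qed

lemma L2sq_add_le:
  fixes f g :: "real ^ 'n \<Rightarrow> 'a::euclidean_space"
  assumes [measurable]: "f \<in> borel_measurable borel" "g \<in> borel_measurable borel"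
  shows "L2sq \<beta> (\<lambda>x. f x + g x) \<le> 2 * L2sq \<beta> f + 2 * L2sq \<beta> g"
proof -
  have "L2sq \<beta> (\<lambda>x. f x + g x) \<le>
    (\<integral>\<^sup>+x. 2 * (ennreal ((norm (f x))\<^sup>2) * ennreal (rho x powr \<beta>) * indicator (ball 0 1) x)
      + 2 * (ennreal ((norm (g x))\<^sup>2) * ennreal (rho x powr \<beta>) * indicator (ball 0 1) x) \<partial>lborel)"
    unfolding L2sq_def
  proof (intro nn_integral_mono)
    fix x
    have "ennreal ((norm (f x + g x))\<^sup>2) * (ennreal (rho x powr \<beta>) * indicator (ball 0 1) x)
      \<le> (2 * ennreal ((norm (f x))\<^sup>2) + 2 * ennreal ((norm (g x))\<^sup>2)) * (ennreal (rho x powr \<beta>) * indicator (ball 0 1) x)"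
      by (intro mult_right_mono ennreal_norm_add_sq_le) simp
    then show "ennreal ((norm (f x + g x))\<^sup>2) * ennreal (rho x powr \<beta>) * indicator (ball 0 1) x
      \<le> 2 * (ennreal ((norm (f x))\<^sup>2) * ennreal (rho x powr \<beta>) * indicator (ball 0 1) x)
      + 2 * (ennreal ((norm (g x))\<^sup>2) * ennreal (rho x powr \<beta>) * indicator (ball 0 1) x)"
      by (simp add: distrib_right mult.assoc)
  qed
  also have "\<dots> = 2 * L2sq \<beta> f + 2 * L2sq \<beta> g"
    unfolding L2sq_def by (simp add: nn_integral_add nn_integral_cmult)
  finally show ?thesis .
qed

lemma L2sq_tendsto_0:
  fixes F :: "nat \<Rightarrow> real ^ 'n \<Rightarrow> 'a::euclidean_space"
  assumes [measurable]: "\<And>n. F n \<in> borel_measurable borel" "W \<in> borel_measurable borel"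
    and W: "(\<integral>\<^sup>+x\<in>ball 0 1. ennreal (W x) * ennreal (rho x powr \<beta>) \<partial>lborel) < \<infinity>"
    and bound: "\<And>n x. x \<in> ball 0 1 \<Longrightarrow> (norm (F n x))\<^sup>2 \<le> W x"
    and lim: "AE x in lborel. x \<in> ball 0 1 \<longrightarrow> (\<lambda>n. F n x) \<longlonglongrightarrow> 0"
  shows "(\<lambda>n. L2sq \<beta> (F n)) \<longlonglongrightarrow> 0"
proof -
  have "(\<lambda>n. L2sq \<beta> (F n)) \<longlonglongrightarrow> (\<integral>\<^sup>+x. 0 \<partial>(lborel :: (real ^ 'n) measure))"
    unfolding L2sq_def
  proof (rule nn_integral_dominated_convergence[OF _ _ _ _ W])
    show "AE x in lborel. ennreal ((norm (F n x))\<^sup>2) * ennreal (rho x powr \<beta>) * indicator (ball 0 1) x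
        \<le> ennreal (W x) * ennreal (rho x powr \<beta>) * indicator (ball 0 1) x" for n
    proof (intro AE_I2)
      fix x :: "real ^ 'n"
      show "ennreal ((norm (F n x))\<^sup>2) * ennreal (rho x powr \<beta>) * indicator (ball 0 1) x
        \<le> ennreal (W x) * ennreal (rho x powr \<beta>) * indicator (ball 0 1) x"
        using bound[of x n] by (cases "x \<in> ball 0 1") (auto intro!: mult_right_mono ennreal_leI)
    qed
    show "AE x in lborel. (\<lambda>n. ennreal ((norm (F n x))\<^sup>2) * ennreal (rho x powr \<beta>) * indicator (ball 0 1) x) \<longlonglongrightarrow> 0"
      using lim
    proof eventually_elim
      case (elim x)
      show ?case
      proof (cases "x \<in> ball 0 1")
        case True
        then have "(\<lambda>n. (norm (F n x))\<^sup>2 * rho x powr \<beta>) \<longlonglongrightarrow> (norm (0 :: 'a))\<^sup>2 * rho x powr \<beta>"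
          using elim by (intro tendsto_intros) auto
        then have "(\<lambda>n. ennreal ((norm (F n x))\<^sup>2 * rho x powr \<beta>)) \<longlonglongrightarrow> ennreal 0"
          by (intro tendsto_ennrealI) simp
        with True show ?thesis by (simp add: ennreal_mult)
      qed simp
    qed
  qed measurable
  then show ?thesis by simp
qed

text \<open>Truncation at height \<open>N\<close> costs little by dominated convergence. The
  truncated function is almost everywhere a limit of continuous functions, and bounded convergence
  applies once these are bounded as well.\<close>

lemma L2sq_approx_continuous:
  fixes f :: "real ^ 'n \<Rightarrow> 'a::euclidean_space"
  assumes f[measurable]: "f \<in> borel_measurable borel" and \<beta>: "\<beta> \<ge> 0"
    and fin: "L2sq \<beta> f < \<infinity>" and \<eta>: "\<eta> > 0"
  obtains g where "continuous_on UNIV g" "L2sq \<beta> (\<lambda>x. f x - g x) < ennreal \<eta>"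
proof -
  have "(\<lambda>n. L2sq \<beta> (\<lambda>x. if norm (f x) \<le> real n then 0 else f x)) \<longlonglongrightarrow> 0"
  proof (rule L2sq_tendsto_0)
    show "(\<integral>\<^sup>+x\<in>ball 0 1. ennreal ((norm (f x))\<^sup>2) * ennreal (rho x powr \<beta>) \<partial>lborel) < \<infinity>"
      using fin by (simp add: L2sq_def)
    show "AE x in lborel. x \<in> ball 0 1 \<longrightarrow> (\<lambda>n. if norm (f x) \<le> real n then 0 else f x) \<longlonglongrightarrow> 0"
    proof (intro AE_I2 impI tendsto_eventually)
      fix x
      obtain m where "norm (f x) \<le> real m" using real_arch_simple by blast
      then show "\<forall>\<^sub>F n in sequentially. (if norm (f x) \<le> real n then 0 else f x) = 0"
        by (intro eventually_sequentiallyI[of m]) auto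
    qed
  qed auto
  then have "\<forall>\<^sub>F n in sequentially. L2sq \<beta> (\<lambda>x. if norm (f x) \<le> real n then 0 else f x) < ennreal (\<eta> / 4)"
    using \<eta> by (intro order_tendstoD) auto
  then obtain N :: nat where N: "L2sq \<beta> (\<lambda>x. if norm (f x) \<le> real N then 0 else f x) < ennreal (\<eta> / 4)"
    by (auto simp: eventually_sequentially)
  define h where "h x = (if norm (f x) \<le> real N then f x else 0)" for x
  have h_meas [measurable]: "h \<in> borel_measurable borel" unfolding h_def by measurable
  have h_le: "norm (h x) \<le> real N" for x by (simp add: h_def)
  have "h measurable_on UNIV"
    using h_meas by (intro lebesgue_measurable_imp_measurable_on) (auto simp: measurable_completion)
  then obtain S g where S: "negligible S" and g: "\<And>n. continuous_on UNIV (g n)"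
    "\<And>x. x \<notin> S \<Longrightarrow> (\<lambda>n. g n x) \<longlonglongrightarrow> h x"
    unfolding measurable_on_def by auto
  \<comment> \<open>Projecting the continuous approximants onto the ball of radius \<open>N\<close>
    bounds them uniformly, keeps them continuous and does not change the limit
    \<open>h\<close>.\<close>
  let ?P = "closest_point (cball (0 :: 'a) (real N))"
  have P_cont: "continuous_on T ?P" for T by (intro continuous_on_closest_point) auto
  have P_le: "norm (?P y) \<le> real N" for y
    using closest_point_in_set[of "cball (0 :: 'a) (real N)" y] by simp
  have P_h: "?P (h x) = h x" for x using h_le[of x] by (intro closest_point_self) simp
  have Pg_cont: "continuous_on UNIV (\<lambda>x. ?P (g n x))" for n
    by (rule continuous_on_compose2[OF P_cont g(1)]) auto
  note [measurable] = borel_measurable_continuous_onI[OF Pg_cont]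
  have "(\<lambda>n. L2sq \<beta> (\<lambda>x. h x - ?P (g n x))) \<longlonglongrightarrow> 0"
  proof (rule L2sq_tendsto_0)
    show "(norm (h x - ?P (g n x)))\<^sup>2 \<le> (2 * real N)\<^sup>2" for n x
      using norm_triangle_ineq4[of "h x" "?P (g n x)"] h_le[of x] P_le[of "g n x"] by (intro power_mono) auto
    have "(\<integral>\<^sup>+x\<in>ball (0 :: real ^ 'n) 1. ennreal ((2 * real N)\<^sup>2) * ennreal (rho x powr \<beta>) \<partial>lborel) \<le>
        (\<integral>\<^sup>+x. ennreal ((2 * real N)\<^sup>2) * indicator (ball (0 :: real ^ 'n) 1) x \<partial>lborel)"
    proof (intro nn_integral_mono)
      fix x :: "real ^ 'n"
      show "ennreal ((2 * real N)\<^sup>2) * ennreal (rho x powr \<beta>) * indicator (ball 0 1) x \<le> ennreal ((2 * real N)\<^sup>2) * indicator (ball 0 1) x"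
        using rho_powr_le_1[OF \<beta>, of x] mult_left_mono[of "ennreal (rho x powr \<beta>)" 1 "ennreal ((2 * real N)\<^sup>2)"]
        by (cases "x \<in> ball 0 1") auto
    qed
    also have "\<dots> = ennreal ((2 * real N)\<^sup>2) * emeasure lborel (ball (0 :: real ^ 'n) 1)"
      by (simp add: nn_integral_cmult)
    also have "\<dots> < \<infinity>"
      using emeasure_bounded_finite[OF bounded_ball[of "0 :: real ^ 'n" 1]] by (simp add: ennreal_mult_less_top)
    finally show "(\<integral>\<^sup>+x\<in>ball 0 1. ennreal ((2 * real N)\<^sup>2) * ennreal (rho (x :: real ^ 'n) powr \<beta>) \<partial>lborel) < \<infinity>" .
    have "AE x in lebesgue. x \<notin> S"
      using S by (intro AE_not_in) (simp add: negligible_iff_null_sets)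
    then have "AE x in lborel. x \<notin> S" by (simp add: AE_completion_iff)
    then show "AE x in lborel. x \<in> ball 0 1 \<longrightarrow> (\<lambda>n. h x - ?P (g n x)) \<longlonglongrightarrow> 0"
    proof eventually_elim
      case (elim x)
      have "(\<lambda>n. ?P (g n x)) \<longlonglongrightarrow> ?P (h x)"
        using g(2)[OF elim] by (rule continuous_on_tendsto_compose[OF P_cont[of UNIV]]) auto
      then have "(\<lambda>n. h x - ?P (g n x)) \<longlonglongrightarrow> h x - h x"
        unfolding P_h by (intro tendsto_diff tendsto_const)
      then show ?case by simp
    qed
  qed measurable
  then have "\<forall>\<^sub>F n in sequentially. L2sq \<beta> (\<lambda>x. h x - ?P (g n x)) < ennreal (\<eta> / 4)"
    using \<eta> by (intro order_tendstoD) auto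
  then obtain n where n: "L2sq \<beta> (\<lambda>x. h x - ?P (g n x)) < ennreal (\<eta> / 4)"
    by (auto simp: eventually_sequentially)
  have "L2sq \<beta> (\<lambda>x. f x - ?P (g n x)) = L2sq \<beta> (\<lambda>x. (if norm (f x) \<le> real N then 0 else f x) + (h x - ?P (g n x)))"
    by (rule arg_cong[of _ _ "L2sq \<beta>"]) (auto simp: h_def)
  also have "\<dots> \<le> 2 * L2sq \<beta> (\<lambda>x. if norm (f x) \<le> real N then 0 else f x) + 2 * L2sq \<beta> (\<lambda>x. h x - ?P (g n x))"
    by (intro L2sq_add_le) measurable
  also have "\<dots> < 2 * ennreal (\<eta> / 4) + 2 * ennreal (\<eta> / 4)"
    using N n by (intro add_strict_mono ennreal_mult_strict_left_mono) auto
  also have "\<dots> = ennreal \<eta>"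
  proof -
    have "2 * ennreal (\<eta> / 4) = ennreal (\<eta> / 2)"
      using \<eta> ennreal_mult[of 2 "\<eta> / 4"] by simp
    then show ?thesis using \<eta> by (simp flip: ennreal_plus)
  qed
  finally show ?thesis using that Pg_cont by blast
qed

section \<open>Averages over pairs of points linked by the kernel\<close>

context dilation_mollifier
begin

text \<open>By Jensen's inequality such an average dominates the weighted square norm of a kernel
  integral, so error bounds reduce to pointwise inequalities in the pair \<open>x\<close>,
  \<open>w\<close> on the support of the kernel.\<close>

definition kernel_average :: "real \<Rightarrow> (real ^ 'n \<Rightarrow> real ^ 'n \<Rightarrow> ennreal) \<Rightarrow> ennreal" where
  "kernel_average \<beta> F = (\<integral>\<^sup>+x\<in>ball 0 1.
    (\<integral>\<^sup>+w. ennreal (kernel x w) * F x w \<partial>lborel) * ennreal (rho x powr \<beta>) \<partial>lborel)"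

lemma kernel_average_mono:
  assumes "\<And>x w. x \<in> ball 0 1 \<Longrightarrow> kernel x w \<noteq> 0 \<Longrightarrow> F x w \<le> G x w"
  shows "kernel_average \<beta> F \<le> kernel_average \<beta> G"
  unfolding kernel_average_def
proof (intro nn_integral_mono)
  fix x :: "real ^ 'n"
  show "(\<integral>\<^sup>+w. ennreal (kernel x w) * F x w \<partial>lborel) * ennreal (rho x powr \<beta>) * indicator (ball 0 1) x
    \<le> (\<integral>\<^sup>+w. ennreal (kernel x w) * G x w \<partial>lborel) * ennreal (rho x powr \<beta>) * indicator (ball 0 1) x"
  proof (cases "x \<in> ball 0 1")
    case True
    have "ennreal (kernel x w) * F x w \<le> ennreal (kernel x w) * G x w" for w
      using assms[OF True, of w] by (cases "kernel x w = 0") (auto intro: mult_left_mono)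
    then show ?thesis by (intro mult_right_mono nn_integral_mono) auto
  qed simp
qed

lemma kernel_average_add_cmult:
  assumes [measurable]: "(\<lambda>(x, w). F x w) \<in> borel_measurable (borel \<Otimes>\<^sub>M borel)"
    "(\<lambda>(x, w). G x w) \<in> borel_measurable (borel \<Otimes>\<^sub>M borel)"
  shows "kernel_average \<beta> (\<lambda>x w. c * F x w + d * G x w) = c * kernel_average \<beta> F + d * kernel_average \<beta> G"
proof -
  have m [measurable]: "(\<lambda>(x, w). kernel x w) \<in> borel_measurable (borel \<Otimes>\<^sub>M borel)"
    unfolding kernel_def split_beta' by measurable
  have "kernel_average \<beta> (\<lambda>x w. c * F x w + d * G x w) =
    (\<integral>\<^sup>+x. c * ((\<integral>\<^sup>+w. ennreal (kernel x w) * F x w \<partial>lborel) * ennreal (rho x powr \<beta>) * indicator (ball 0 1) x)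
      + d * ((\<integral>\<^sup>+w. ennreal (kernel x w) * G x w \<partial>lborel) * ennreal (rho x powr \<beta>) * indicator (ball 0 1) x) \<partial>lborel)"
    unfolding kernel_average_def
  proof (intro nn_integral_cong)
    fix x :: "real ^ 'n"
    have "(\<integral>\<^sup>+w. ennreal (kernel x w) * (c * F x w + d * G x w) \<partial>lborel) =
      (\<integral>\<^sup>+w. c * (ennreal (kernel x w) * F x w) + d * (ennreal (kernel x w) * G x w) \<partial>lborel)"
      by (intro nn_integral_cong) (simp add: distrib_left mult_ac)
    also have "\<dots> = c * (\<integral>\<^sup>+w. ennreal (kernel x w) * F x w \<partial>lborel) + d * (\<integral>\<^sup>+w. ennreal (kernel x w) * G x w \<partial>lborel)"
      by (simp add: nn_integral_add nn_integral_cmult)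
    finally have eq: "(\<integral>\<^sup>+w. ennreal (kernel x w) * (c * F x w + d * G x w) \<partial>lborel) = \<dots>" .
    show "(\<integral>\<^sup>+w. ennreal (kernel x w) * (c * F x w + d * G x w) \<partial>lborel) * ennreal (rho x powr \<beta>) * indicator (ball 0 1) x =
      c * ((\<integral>\<^sup>+w. ennreal (kernel x w) * F x w \<partial>lborel) * ennreal (rho x powr \<beta>) * indicator (ball 0 1) x)
      + d * ((\<integral>\<^sup>+w. ennreal (kernel x w) * G x w \<partial>lborel) * ennreal (rho x powr \<beta>) * indicator (ball 0 1) x)"
      unfolding eq by (simp only: distrib_right mult.assoc)
  qed
  also have "\<dots> = c * kernel_average \<beta> F + d * kernel_average \<beta> G"
    unfolding kernel_average_def by (simp add: nn_integral_add nn_integral_cmult)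
  finally show ?thesis .
qed

lemma kernel_average_fst:
  "kernel_average \<beta> (\<lambda>x w. ennreal ((norm (f x))\<^sup>2)) = L2sq \<beta> f"
  unfolding kernel_average_def L2sq_def by (simp add: nn_integral_multc nn_integral_kernel)

lemma kernel_average_snd:
  assumes "f \<in> borel_measurable borel" "\<beta> \<ge> 0"
  shows "kernel_average \<beta> (\<lambda>x w. ennreal ((norm (f w))\<^sup>2))
      \<le> ennreal (2 ^ DIM(real ^ 'n) * 4 powr \<beta>) * L2sq \<beta> f"
  using nn_integral_kernel_bound[of "\<lambda>w. ennreal ((norm (f w))\<^sup>2)" \<beta>] assms
  by (simp add: kernel_average_def L2sq_def)

lemma kernel_average_const:
  assumes "\<beta> \<ge> 0"
  shows "kernel_average \<beta> (\<lambda>x w. c) \<le> c * emeasure lborel (ball (0 :: real ^ 'n) 1)"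
proof -
  have "kernel_average \<beta> (\<lambda>x w. c) = (\<integral>\<^sup>+x\<in>ball (0 :: real ^ 'n) 1. c * ennreal (rho x powr \<beta>) \<partial>lborel)"
    unfolding kernel_average_def by (simp add: nn_integral_multc nn_integral_kernel)
  also have "\<dots> \<le> (\<integral>\<^sup>+x. c * indicator (ball (0 :: real ^ 'n) 1) x \<partial>lborel)"
  proof (intro nn_integral_mono)
    fix x :: "real ^ 'n"
    show "c * ennreal (rho x powr \<beta>) * indicator (ball 0 1) x \<le> c * indicator (ball 0 1) x"
      using rho_powr_le_1[OF assms, of x] mult_left_mono[of "ennreal (rho x powr \<beta>)" 1 c]
      by (cases "x \<in> ball 0 1") auto
  qed
  also have "\<dots> = c * emeasure lborel (ball (0 :: real ^ 'n) 1)" by (simp add: nn_integral_cmult)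
  finally show ?thesis .
qed

lemma L2sq_le_kernel_average:
  assumes "\<And>x. x \<in> ball 0 1 \<Longrightarrow> H x \<in> borel_measurable borel"
    and "\<And>x. x \<in> ball 0 1 \<Longrightarrow> E x = (LINT w|lborel. kernel x w *\<^sub>R H x w)"
  shows "L2sq \<beta> E \<le> kernel_average \<beta> (\<lambda>x w. ennreal ((norm (H x w))\<^sup>2))"
  unfolding L2sq_def kernel_average_def
proof (intro nn_integral_mono)
  fix x :: "real ^ 'n"
  show "ennreal ((norm (E x))\<^sup>2) * ennreal (rho x powr \<beta>) * indicator (ball 0 1) x
    \<le> (\<integral>\<^sup>+w. ennreal (kernel x w) * ennreal ((norm (H x w))\<^sup>2) \<partial>lborel) * ennreal (rho x powr \<beta>) * indicator (ball 0 1) x"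
    using kernel_jensen[of "H x" x] assms[of x]
    by (cases "x \<in> ball 0 1") (auto intro!: mult_right_mono)
qed

end

text \<open>The kernel lives at distance at most \<open>3 e\<close> from the diagonal, so it suffices to approximate \<open>f\<close> by a
  uniformly continuous function.\<close>

lemma kernel_average_diff_small:
  fixes f :: "real ^ 'n \<Rightarrow> 'a::euclidean_space"
  assumes [measurable]: "f \<in> borel_measurable borel" and \<beta>: "\<beta> \<ge> 0" and fin: "L2sq \<beta> f < \<infinity>" and \<eta>: "\<eta> > 0"
  shows "\<exists>\<delta>>0. \<forall>e \<psi>. dilation_mollifier e \<psi> \<longrightarrow> e < \<delta> \<longrightarrow>
    dilation_mollifier.kernel_average e \<psi> \<beta> (\<lambda>x w. ennreal ((norm (f w - f x))\<^sup>2)) < ennreal \<eta>"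
proof -
  define C where "C = 2 ^ DIM(real ^ 'n) * 4 powr \<beta>"
  define m where "m = measure lborel (ball (0 :: real ^ 'n) 1)"
  have C: "C > 0" by (simp add: C_def)
  \<comment> \<open>With \<open>\<tau>\<close> below, the final bound is 4 C \<mu> + 4 \<tau>^2 m +
    2 \<mu>. The 12 makes the two \<mu>-terms together, and likewise the \<tau>-term, at most
    \<eta>/3.\<close>
  define \<mu> where "\<mu> = \<eta> / (12 * (C + 1))"
  have \<mu>: "\<mu> > 0" using \<eta> C by (simp add: \<mu>_def)
  obtain g where g: "continuous_on UNIV g" "L2sq \<beta> (\<lambda>x. f x - g x) < ennreal \<mu>"
    using L2sq_approx_continuous[OF assms(1-3) \<mu>] by blast
  note [measurable] = borel_measurable_continuous_onI[OF g(1)]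
  define \<tau> where "\<tau> = sqrt (\<eta> / (12 * (m + 1)))"
  have m: "m \<ge> 0" by (simp add: m_def)
  have \<tau>: "\<tau> > 0" "\<tau>\<^sup>2 = \<eta> / (12 * (m + 1))" using \<eta> m by (simp_all add: \<tau>_def)
  have "uniformly_continuous_on (cball 0 1) g"
    using g(1) by (intro compact_uniformly_continuous) (auto intro: continuous_on_subset)
  then obtain \<delta> where \<delta>: "\<delta> > 0"
    "\<And>x y. x \<in> cball 0 1 \<Longrightarrow> y \<in> cball 0 1 \<Longrightarrow> dist y x < \<delta> \<Longrightarrow> dist (g y) (g x) < \<tau>"
    using \<tau>(1) unfolding uniformly_continuous_on_def by blast
  show ?thesis
  proof (intro exI[of _ "\<delta> / 3"] conjI allI impI)
    fix e and \<psi> :: "real ^ 'n \<Rightarrow> real" assume "dilation_mollifier e \<psi>" and e: "e < \<delta> / 3"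
    then interpret dilation_mollifier e \<psi> by simp
    have 1: "kernel_average \<beta> (\<lambda>x w. ennreal ((norm (f w - g w))\<^sup>2)) \<le> ennreal (C * \<mu>)"
    proof -
      have "kernel_average \<beta> (\<lambda>x w. ennreal ((norm (f w - g w))\<^sup>2)) \<le> ennreal C * L2sq \<beta> (\<lambda>x. f x - g x)"
        unfolding C_def by (rule kernel_average_snd[OF _ \<beta>]) measurable
      also have "\<dots> \<le> ennreal C * ennreal \<mu>" using g(2) by (intro mult_left_mono) auto
      also have "\<dots> = ennreal (C * \<mu>)" using C \<mu> by (intro ennreal_mult[symmetric]) auto
      finally show ?thesis .
    qed
    have 2: "kernel_average \<beta> (\<lambda>x w. ennreal ((norm (g x - f x))\<^sup>2)) \<le> ennreal \<mu>"
      unfolding kernel_average_fst using g(2) by (simp add: L2sq_def norm_minus_commute)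
    have 3: "kernel_average \<beta> (\<lambda>x w. ennreal (\<tau>\<^sup>2)) \<le> ennreal (\<tau>\<^sup>2 * m)"
    proof -
      have "emeasure lborel (ball (0 :: real ^ 'n) 1) = ennreal m"
        unfolding m_def using emeasure_bounded_finite[OF bounded_ball[of "0 :: real ^ 'n" 1]]
        by (intro emeasure_eq_ennreal_measure) auto
      then show ?thesis
        using kernel_average_const[OF \<beta>, of "ennreal (\<tau>\<^sup>2)"] m by (simp add: ennreal_mult)
    qed
    \<comment> \<open>The weights 4, 4, 2 come from applying the square inequality for two summands
      twice. The explicit \<open>1 *\<close> gives the sum the shape on which the two-term linearity
      rule works twice.\<close>
    have "kernel_average \<beta> (\<lambda>x w. ennreal ((norm (f w - f x))\<^sup>2)) \<le>
      kernel_average \<beta> (\<lambda>x w. 4 * ennreal ((norm (f w - g w))\<^sup>2) + 1 * (4 * ennreal (\<tau>\<^sup>2) + 2 * ennreal ((norm (g x - f x))\<^sup>2)))"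
    proof (rule kernel_average_mono)
      fix x w assume x: "x \<in> ball 0 1" and k: "kernel x w \<noteq> 0"
      have "w \<in> cball 0 1" "x \<in> cball 0 1" using x kernel_in_ball[OF x k] by auto
      moreover have "dist w x < \<delta>" using kernel_dist[OF x k] e by (simp add: dist_commute)
      ultimately have "dist (g w) (g x) < \<tau>" using \<delta>(2) by blast
      then have gw: "(norm (g w - g x))\<^sup>2 \<le> \<tau>\<^sup>2" by (intro power_mono) (auto simp: dist_norm)
      have "(norm (f w - f x))\<^sup>2 = (norm (((f w - g w) + (g w - g x)) + (g x - f x)))\<^sup>2" by simp
      also have "\<dots> \<le> 2 * (norm ((f w - g w) + (g w - g x)))\<^sup>2 + 2 * (norm (g x - f x))\<^sup>2"
        by (rule norm_add_sq_le)
      also have "\<dots> \<le> 4 * (norm (f w - g w))\<^sup>2 + (4 * \<tau>\<^sup>2 + 2 * (norm (g x - f x))\<^sup>2)"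
        using norm_add_sq_le[of "f w - g w" "g w - g x"] gw by simp
      finally show "ennreal ((norm (f w - f x))\<^sup>2) \<le>
        4 * ennreal ((norm (f w - g w))\<^sup>2) + 1 * (4 * ennreal (\<tau>\<^sup>2) + 2 * ennreal ((norm (g x - f x))\<^sup>2))"
        by (simp add: ennreal_leI flip: ennreal_plus ennreal_mult ennreal_numeral)
    qed
    also have "\<dots> = 4 * kernel_average \<beta> (\<lambda>x w. ennreal ((norm (f w - g w))\<^sup>2)) +
       1 * (4 * kernel_average \<beta> (\<lambda>x w. ennreal (\<tau>\<^sup>2)) + 2 * kernel_average \<beta> (\<lambda>x w. ennreal ((norm (g x - f x))\<^sup>2)))"
      by (subst kernel_average_add_cmult; (subst kernel_average_add_cmult)?; measurable)
    also have "\<dots> \<le> 4 * ennreal (C * \<mu>) + 1 * (4 * ennreal (\<tau>\<^sup>2 * m) + 2 * ennreal \<mu>)"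
      by (intro add_mono mult_left_mono 1 2 3) auto
    also have "\<dots> = ennreal (4 * (C * \<mu>) + (4 * (\<tau>\<^sup>2 * m) + 2 * \<mu>))"
      using C \<mu> m by (simp add: ennreal_mult)
    also have "\<dots> < ennreal \<eta>"
    proof (rule ennreal_lessI[OF \<eta>])
      have "C + 1 \<noteq> 0" using C by simp
      then have "\<mu> * (C + 1) = \<eta> / 12" unfolding \<mu>_def by (simp add: field_simps)
      then have "C * \<mu> + \<mu> = \<eta> / 12" by (simp add: algebra_simps)
      moreover have "\<tau>\<^sup>2 * m \<le> \<eta> / 12"
        unfolding \<tau>(2) using m \<eta> by (simp add: field_simps)
      ultimately show "4 * (C * \<mu>) + (4 * (\<tau>\<^sup>2 * m) + 2 * \<mu>) < \<eta>" using \<mu> \<eta> by linarith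
    qed
    finally show "kernel_average \<beta> (\<lambda>x w. ennreal ((norm (f w - f x))\<^sup>2)) < ennreal \<eta>" .
  qed (use \<delta>(1) in simp)
qed

subsection \<open>Error estimates and weak derivatives of mollifications\<close>

lemma eventually_linear_small:
  assumes "K < (\<infinity> :: ennreal)" "c \<ge> 0" "\<eta> > 0"
  shows "\<forall>\<^sub>F e in at_right 0. ennreal (c * e) * K < ennreal \<eta>"
proof -
  obtain r where r: "K = ennreal r" "r \<ge> 0" using assms(1) by (cases K) auto
  have "((\<lambda>e. c * e * r) \<longlongrightarrow> c * 0 * r) (at_right 0)" by (intro tendsto_intros)
  then have "\<forall>\<^sub>F e in at_right 0. c * e * r < \<eta>"
    using assms(3) by (intro order_tendstoD) auto
  moreover have "\<forall>\<^sub>F e in at_right (0 :: real). e > 0"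
    by (simp add: eventually_at_right_less)
  ultimately show ?thesis
  proof eventually_elim
    case (elim e)
    have "ennreal (c * e) * K = ennreal (c * e * r)"
      unfolding r(1) using elim r(2) assms(2) by (intro ennreal_mult[symmetric]) auto
    also have "\<dots> < ennreal \<eta>" using elim assms(3) by (intro ennreal_lessI)
    finally show ?case .
  qed
qed

text \<open>The three components of the approximation error all have the form of \<open>E\<close>, with a remainder
  \<open>R\<close> that comes from the dilation and from the commutator with the rotation fields.\<close>

definition small_error ::
    "real \<Rightarrow> real \<Rightarrow> real \<Rightarrow> (real ^ 'n \<Rightarrow> 'a::euclidean_space) \<Rightarrow> (real ^ 'n \<Rightarrow> real) \<Rightarrow> real \<Rightarrow> bool" where
  "small_error e \<beta> \<eta> f G c \<longleftrightarrow> (\<forall>\<psi> E R. dilation_mollifier e \<psi> \<longrightarrow>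
    (\<forall>x\<in>ball 0 1. R x \<in> borel_measurable borel \<and>
      E x = (LINT w|lborel. dilation_mollifier.kernel e \<psi> x w *\<^sub>R (f x - f w + R x w)) \<and>
      (\<forall>w. dilation_mollifier.kernel e \<psi> x w \<noteq> 0 \<longrightarrow> (norm (R x w))\<^sup>2 \<le> c * e * (G w)\<^sup>2)) \<longrightarrow>
    L2sq \<beta> E < ennreal \<eta>)"

lemma (in dilation_mollifier) small_errorD:
  assumes "small_error e \<beta> \<eta> f G c"
    and "\<And>x. x \<in> ball 0 1 \<Longrightarrow> R x \<in> borel_measurable borel"
    and "\<And>x. x \<in> ball 0 1 \<Longrightarrow> E x = (LINT w|lborel. kernel x w *\<^sub>R (f x - f w + R x w))"
    and "\<And>x w. x \<in> ball 0 1 \<Longrightarrow> kernel x w \<noteq> 0 \<Longrightarrow> (norm (R x w))\<^sup>2 \<le> c * e * (G w)\<^sup>2"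
  shows "L2sq \<beta> E < ennreal \<eta>"
  using assms dilation_mollifier_axioms unfolding small_error_def by blast

text \<open>The part f(x) - f(w) is small by approximation with continuous functions; the remainder
  contributes at most a fixed multiple of e times \<open>L2sq \<beta> G\<close>. The estimate is
  uniform in the mollifier, so only \<open>e\<close> is left to be chosen.\<close>

lemma eventually_small_error:
  fixes f :: "real ^ 'n \<Rightarrow> 'a::euclidean_space" and G :: "real ^ 'n \<Rightarrow> real"
  assumes [measurable]: "f \<in> borel_measurable borel" "G \<in> borel_measurable borel"
    and fin: "L2sq \<beta> f < \<infinity>" "L2sq \<beta> G < \<infinity>" and \<beta>: "\<beta> \<ge> 0" and c: "c \<ge> 0" and \<eta>: "\<eta> > 0"
  shows "\<forall>\<^sub>F e in at_right 0. small_error e \<beta> \<eta> f G c"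
proof -
  define C where "C = 2 ^ DIM(real ^ 'n) * 4 powr \<beta>"
  obtain \<delta> where \<delta>: "\<delta> > 0" "\<And>e \<psi>. dilation_mollifier e \<psi> \<Longrightarrow> e < \<delta> \<Longrightarrow>
    dilation_mollifier.kernel_average e \<psi> \<beta> (\<lambda>x w. ennreal ((norm (f w - f x))\<^sup>2)) < ennreal (\<eta> / 4)"
    using kernel_average_diff_small[OF assms(1) \<beta> fin(1), of "\<eta> / 4"] \<eta> by auto
  have "ennreal C * L2sq \<beta> G < \<infinity>" using fin(2) by (simp add: ennreal_mult_less_top)
  then have "\<forall>\<^sub>F e in at_right 0. ennreal (c * e) * (ennreal C * L2sq \<beta> G) < ennreal (\<eta> / 4)"
    using c \<eta> by (intro eventually_linear_small) auto
  moreover have "\<forall>\<^sub>F e in at_right 0. e < \<delta>"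
    using \<delta>(1) by (auto simp: eventually_at_right_field)
  ultimately show ?thesis
  proof eventually_elim
    case (elim e)
    show ?case
      unfolding small_error_def
    proof (intro allI impI)
      fix \<psi> :: "real ^ 'n \<Rightarrow> real" and E :: "real ^ 'n \<Rightarrow> 'a" and R :: "real ^ 'n \<Rightarrow> real ^ 'n \<Rightarrow> 'a"
      assume "dilation_mollifier e \<psi>"
      then interpret dilation_mollifier e \<psi> .
      assume "\<forall>x\<in>ball 0 1. R x \<in> borel_measurable borel \<and>
        E x = (LINT w|lborel. kernel x w *\<^sub>R (f x - f w + R x w)) \<and>
        (\<forall>w. kernel x w \<noteq> 0 \<longrightarrow> (norm (R x w))\<^sup>2 \<le> c * e * (G w)\<^sup>2)"
      then have R: "\<And>x. x \<in> ball 0 1 \<Longrightarrow> R x \<in> borel_measurable borel"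
        "\<And>x. x \<in> ball 0 1 \<Longrightarrow> E x = (LINT w|lborel. kernel x w *\<^sub>R (f x - f w + R x w))"
        "\<And>x w. x \<in> ball 0 1 \<Longrightarrow> kernel x w \<noteq> 0 \<Longrightarrow> (norm (R x w))\<^sup>2 \<le> c * e * (G w)\<^sup>2"
        by blast+
      have "L2sq \<beta> E \<le> kernel_average \<beta> (\<lambda>x w. ennreal ((norm (f x - f w + R x w))\<^sup>2))"
      proof (rule L2sq_le_kernel_average)
        show "(\<lambda>w. f x - f w + R x w) \<in> borel_measurable borel" if "x \<in> ball 0 1" for x
          using R(1)[OF that] by measurable
      qed (rule R(2))
      also have "\<dots> \<le> kernel_average \<beta> (\<lambda>x w. 2 * ennreal ((norm (f w - f x))\<^sup>2) + ennreal (2 * (c * e)) * ennreal ((norm (G w))\<^sup>2))"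
      proof (rule kernel_average_mono)
        fix x w assume x: "x \<in> ball 0 1" and k: "kernel x w \<noteq> 0"
        have "(norm (f x - f w + R x w))\<^sup>2 \<le> 2 * (norm (f x - f w))\<^sup>2 + 2 * (norm (R x w))\<^sup>2"
          by (rule norm_add_sq_le)
        also have "\<dots> \<le> 2 * (norm (f w - f x))\<^sup>2 + (2 * (c * e)) * (norm (G w))\<^sup>2"
          using R(3)[OF x k] by (simp add: norm_minus_commute)
        finally have "ennreal ((norm (f x - f w + R x w))\<^sup>2) \<le> ennreal (2 * (norm (f w - f x))\<^sup>2 + (2 * (c * e)) * (norm (G w))\<^sup>2)"
          by (rule ennreal_leI)
        also have "\<dots> = 2 * ennreal ((norm (f w - f x))\<^sup>2) + ennreal (2 * (c * e)) * ennreal ((norm (G w))\<^sup>2)"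
          using c e_pos by (simp add: ennreal_mult)
        finally show "ennreal ((norm (f x - f w + R x w))\<^sup>2) \<le> 2 * ennreal ((norm (f w - f x))\<^sup>2) + ennreal (2 * (c * e)) * ennreal ((norm (G w))\<^sup>2)" .
      qed
      also have "\<dots> = 2 * kernel_average \<beta> (\<lambda>x w. ennreal ((norm (f w - f x))\<^sup>2)) + ennreal (2 * (c * e)) * kernel_average \<beta> (\<lambda>x w. ennreal ((norm (G w))\<^sup>2))"
        by (rule kernel_average_add_cmult) measurable
      also have "\<dots> \<le> 2 * kernel_average \<beta> (\<lambda>x w. ennreal ((norm (f w - f x))\<^sup>2)) + ennreal (2 * (c * e)) * (ennreal C * L2sq \<beta> G)"
        unfolding C_def by (intro add_mono mult_left_mono kernel_average_snd \<beta>) auto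
      also have "\<dots> = 2 * kernel_average \<beta> (\<lambda>x w. ennreal ((norm (f w - f x))\<^sup>2)) + 2 * (ennreal (c * e) * (ennreal C * L2sq \<beta> G))"
        using c e_pos by (simp add: ennreal_mult mult.assoc)
      also have "\<dots> < 2 * ennreal (\<eta> / 4) + 2 * ennreal (\<eta> / 4)"
        using elim \<delta>(2)[OF dilation_mollifier_axioms] by (intro add_strict_mono ennreal_mult_strict_left_mono) auto
      also have "\<dots> = ennreal \<eta>"
      proof -
        have "2 * ennreal (\<eta> / 4) = ennreal (\<eta> / 2)"
          using \<eta> ennreal_mult[of 2 "\<eta> / 4"] by simp
        then show ?thesis using \<eta> by (simp flip: ennreal_plus)
      qed
      finally show "L2sq \<beta> E < ennreal \<eta>" .
    qed
  qed
qed

section \<open>Passage between the Lebesgue formulation and Borel representatives\<close>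

lemma L2sq_AE_cong:
  assumes "AE x in lborel. x \<in> ball 0 1 \<longrightarrow> f x = g x"
  shows "L2sq \<beta> f = L2sq \<beta> g"
  unfolding L2sq_def using assms
  by (intro nn_integral_cong_AE, eventually_elim) (auto simp: indicator_def)

lemma AE_lebesgue_on_ball_iff:
  "(AE x in lebesgue_on (ball 0 1). P x) \<longleftrightarrow> (AE x in lborel. x \<in> ball (0 :: 'b::euclidean_space) 1 \<longrightarrow> P x)"
  by (subst AE_restrict_space_iff) (simp_all add: AE_completion_iff)

lemma nn_integral_lebesgue_on_ball_eq_L2sq:
  "(\<integral>\<^sup>+x. ennreal ((norm (f x))\<^sup>2 * rho x powr \<beta>) \<partial>lebesgue_on (ball 0 1)) = L2sq \<beta> f"
  by (subst nn_integral_restrict_space) (simp_all add: L2sq_def nn_integral_completion ennreal_mult)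

text \<open>If the integrand is not integrable, the Bochner integral is 0 and
  \<open>c \<ge> 0\<close> gives the bound; otherwise both integrals agree.\<close>

lemma L2w_norm_sq_le:
  assumes "L2sq \<beta> f \<le> ennreal c" "c \<ge> 0"
  shows "(L2w_norm (\<lambda>x. rho x powr \<beta>) f)\<^sup>2 \<le> c"
proof -
  let ?I = "LINT x|lebesgue_on (ball 0 1). (norm (f x))\<^sup>2 * rho x powr \<beta>"
  have "?I \<ge> 0" by (intro integral_nonneg_AE AE_I2) simp
  moreover have "?I \<le> c"
  proof (cases "integrable (lebesgue_on (ball 0 1)) (\<lambda>x. (norm (f x))\<^sup>2 * rho x powr \<beta>)")
    case True
    then have I: "ennreal ?I = L2sq \<beta> f"
      by (subst nn_integral_lebesgue_on_ball_eq_L2sq[symmetric], subst nn_integral_eq_integral) auto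
    have "ennreal ?I \<le> ennreal c" unfolding I by (rule assms(1))
    with assms(2) show ?thesis by (subst (asm) ennreal_le_iff)
  qed (use assms in \<open>simp add: not_integrable_integral_eq\<close>)
  ultimately show ?thesis by (simp add: L2w_norm_def)
qed

lemma L2w_borel_representative:
  fixes f :: "real ^ 'n \<Rightarrow> 'a::euclidean_space"
  assumes f: "f \<in> L2w (\<lambda>x. rho x powr \<beta>)"
  obtains f' where "f' \<in> borel_measurable borel" "AE x in lborel. x \<in> ball 0 1 \<longrightarrow> f x = f' x"
    "L2sq \<beta> f' < \<infinity>"
proof -
  have "(\<lambda>x. if x \<in> ball 0 1 then f x else 0) \<in> borel_measurable lebesgue"
    using f borel_measurable_if[of "ball 0 1" f] by (simp add: L2w_def)
  then obtain f' where f': "f' \<in> borel_measurable borel" "AE x in lborel. (if x \<in> ball 0 1 then f x else 0) = f' x"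
    by (rule lebesgue_borel_representative)
  have ae: "AE x in lborel. x \<in> ball 0 1 \<longrightarrow> f x = f' x"
    using f'(2) by (rule eventually_mono) auto
  have "L2sq \<beta> f' = L2sq \<beta> f"
    using ae by (rule L2sq_AE_cong[symmetric])
  also have "\<dots> < \<infinity>"
    using f unfolding nn_integral_lebesgue_on_ball_eq_L2sq[symmetric] L2w_def integrable_iff_bounded by auto
  finally show ?thesis using that f'(1) ae by blast
qed

lemma integrable_cball_representative:
  fixes f :: "real ^ 'n \<Rightarrow> 'a::euclidean_space"
  assumes f: "locally_integrable f" and f': "f' \<in> borel_measurable borel"
    and ae: "AE x in lborel. x \<in> ball 0 1 \<longrightarrow> f x = f' x" and r: "r < 1"
  shows "integrable lborel (\<lambda>x. indicator (cball 0 r) x *\<^sub>R f' x)"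
proof -
  have sub: "cball 0 r \<subseteq> ball (0 :: real ^ 'n) 1" using r by auto
  have 1: "integrable lebesgue (\<lambda>x. indicator (cball 0 r) x *\<^sub>R f x)"
    by (rule locally_integrable_compact[OF f compact_cball sub])
  have m: "(\<lambda>x. indicator (cball 0 r) x *\<^sub>R f' x) \<in> borel_measurable borel"
    using f' by measurable
  have "AE x in lebesgue. indicator (cball 0 r) x *\<^sub>R f x = indicator (cball 0 r) x *\<^sub>R f' x"
    using AE_completion[OF ae] by (rule eventually_mono) (use sub in \<open>auto simp: indicator_def\<close>)
  then have "integrable lebesgue (\<lambda>x. indicator (cball 0 r) x *\<^sub>R f' x)"
    by (rule integrable_cong_AE_imp[OF 1 measurable_completion[OF m[folded measurable_lborel2]]])
  then show ?thesis using m by (simp add: integrable_completion)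
qed

text \<open>The link between the two sides of the weak derivative argument: the definition
  integrates \<open>v\<close> over the ball, the convolution integrates a cut-off Borel
  representative over the whole space. The cut-off is invisible to \<open>\<theta>\<close>.\<close>

lemma integral_ball_eq_lborel:
  fixes v :: "real ^ 'n \<Rightarrow> 'a::euclidean_space"
  assumes v: "locally_integrable v" and v': "v' \<in> borel_measurable borel"
    and ae: "AE x in lborel. x \<in> ball 0 1 \<longrightarrow> v x = v' x" and r: "r < 1"
    and \<theta>: "continuous_on UNIV \<theta>" "\<And>x. x \<notin> cball 0 r \<Longrightarrow> \<theta> x = 0"
  shows "(LINT x|lebesgue_on (ball 0 1). \<theta> x *\<^sub>R v x) = (LINT x|lborel. \<theta> x *\<^sub>R (indicator (cball 0 r) x *\<^sub>R v' x))"
proof -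
  have sub: "cball 0 r \<subseteq> ball (0 :: real ^ 'n) 1" using r by auto
  note int = integrable_scaleR_locally_integrable[OF v compact_cball sub \<theta>]
  have [measurable]: "\<theta> \<in> borel_measurable borel" by (rule borel_measurable_continuous_onI[OF \<theta>(1)])
  have m: "(\<lambda>x. \<theta> x *\<^sub>R (indicator (cball 0 r) x *\<^sub>R v' x)) \<in> borel_measurable borel"
    using v' by measurable
  have "(LINT x|lebesgue_on (ball 0 1). \<theta> x *\<^sub>R v x) = (LINT x|lebesgue. \<theta> x *\<^sub>R v x)"
    by (rule int(3))
  also have "\<dots> = (LINT x|lebesgue. \<theta> x *\<^sub>R (indicator (cball 0 r) x *\<^sub>R v' x))"
  proof (rule integral_cong_AE)
    show "(\<lambda>x. \<theta> x *\<^sub>R v x) \<in> borel_measurable lebesgue"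
      by (rule borel_measurable_integrable[OF int(1)])
    show "(\<lambda>x. \<theta> x *\<^sub>R (indicator (cball 0 r) x *\<^sub>R v' x)) \<in> borel_measurable lebesgue"
      by (rule measurable_completion[OF m[folded measurable_lborel2]])
    show "AE x in lebesgue. \<theta> x *\<^sub>R v x = \<theta> x *\<^sub>R (indicator (cball 0 r) x *\<^sub>R v' x)"
      using AE_completion[OF ae]
    proof (rule eventually_mono)
      fix x assume "x \<in> ball 0 1 \<longrightarrow> v x = v' x"
      then show "\<theta> x *\<^sub>R v x = \<theta> x *\<^sub>R (indicator (cball 0 r) x *\<^sub>R v' x)"
        using \<theta>(2)[of x] sub by (cases "x \<in> cball 0 r") auto
    qed
  qed
  also have "\<dots> = (LINT x|lborel. \<theta> x *\<^sub>R (indicator (cball 0 r) x *\<^sub>R v' x))"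
    using m by (intro integral_completion) simp
  finally show ?thesis .
qed

text \<open>The function \<open>w \<mapsto> kernel x w\<close> is a test function, so the weak derivative can be moved
  inside the convolution.\<close>

lemma (in dilation_mollifier) partial_smoothing:
  fixes v g :: "real ^ 'n \<Rightarrow> 'a::euclidean_space"
  assumes weak: "has_weak_partial i v g"
    and v': "v' \<in> borel_measurable borel" "AE x in lborel. x \<in> ball 0 1 \<longrightarrow> v x = v' x"
    and g': "g' \<in> borel_measurable borel" "AE x in lborel. x \<in> ball 0 1 \<longrightarrow> g x = g' x"
    and x: "x \<in> ball 0 1"
  shows "partial i (smoothing v') x = (1 - 2 * e) *\<^sub>R smoothing g' x"
proof -
  let ?t = "1 - 2 * e" and ?K = "cball (0 :: real ^ 'n) (1 - e)"
  have loc: "locally_integrable v" "locally_integrable g" using weak by (auto simp: has_weak_partial_def)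
  have r: "1 - e < 1" using e_pos by simp
  have V: "integrable lborel (\<lambda>w. indicator ?K w *\<^sub>R v' w)"
    by (rule integrable_cball_representative[OF loc(1) v' r])
  define \<phi> where "\<phi> w = \<psi> (?t *\<^sub>R x - w)" for w
  have \<phi>_bump: "\<phi> \<in> bump_algebra"
    using bump_algebra_affine[OF bump, of "- 1" "?t *\<^sub>R x"] by (simp add: \<phi>_def[abs_def])
  have \<phi>_supp: "\<phi> w = 0" if "w \<notin> ?K" for w
    using kernel_support[OF x, of w] that unfolding kernel_def \<phi>_def by blast
  have \<phi>_sub: "closure {w. \<phi> w \<noteq> 0} \<subseteq> ?K"
    using \<phi>_supp by (intro closure_minimal closed_cball) blast
  have \<phi>_test: "test_function \<phi>"
  proof (rule bump_algebra_test_function[OF \<phi>_bump])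
    show "{w. \<phi> w \<noteq> 0} \<subseteq> ?K" using \<phi>_supp by blast
    show "?K \<subseteq> ball 0 1" using e_pos by auto
  qed simp
  \<comment> \<open>The sign comes from the reflection in \<open>w\<close>; it will cancel the sign
    of the integration by parts.\<close>
  have \<phi>_partial: "partial i \<phi> w = - partial i \<psi> (?t *\<^sub>R x - w)" for w
  proof -
    let ?D = "frechet_derivative \<psi> (at (?t *\<^sub>R x - w))"
    have D: "(\<psi> has_derivative ?D) (at (?t *\<^sub>R x - w))"
      using bump_algebra_differentiable[OF bump] by (simp add: frechet_derivative_works)
    have "((\<lambda>w. ?t *\<^sub>R x - w) has_derivative (\<lambda>h. - h)) (at w)"
      by (auto intro!: derivative_eq_intros)
    from has_derivative_compose[OF this D] have "(\<phi> has_derivative (\<lambda>h. ?D (- h))) (at w)"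
      by (simp add: \<phi>_def[abs_def])
    moreover have "?D (- h) = - ?D h" for h
      by (rule linear_neg[OF bounded_linear.linear[OF has_derivative_bounded_linear[OF D]]])
    ultimately have "(\<phi> has_derivative (\<lambda>h. - ?D h)) (at w)" by simp
    from partial_eqI[OF this, of i] show ?thesis by (simp only: partial_def)
  qed
  have \<phi>_partial_supp: "partial i \<phi> w = 0" if "w \<notin> ?K" for w
    using test_function_facts(8)[OF \<phi>_test] \<phi>_sub that by blast
  note cont = test_function_facts(5,6)[OF \<phi>_test, of UNIV]
  have "\<psi> y = 0" if "norm y > e" for y using that support[of y] by linarith
  then have "partial i (smoothing v') x = ?t *\<^sub>R dilated_convolution ?t (partial i \<psi>) (\<lambda>w. indicator ?K w *\<^sub>R v' w) x"
    unfolding smoothing_def using bump V by (intro partial_dilated_convolution)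
  also have "dilated_convolution ?t (partial i \<psi>) (\<lambda>w. indicator ?K w *\<^sub>R v' w) x
      = - (LINT w|lborel. partial i \<phi> w *\<^sub>R (indicator ?K w *\<^sub>R v' w))"
    unfolding dilated_convolution_def \<phi>_partial by (simp flip: Bochner_Integration.integral_minus)
  also have "(LINT w|lborel. partial i \<phi> w *\<^sub>R (indicator ?K w *\<^sub>R v' w)) = (LINT w|lebesgue_on (ball 0 1). partial i \<phi> w *\<^sub>R v w)"
    by (rule integral_ball_eq_lborel[OF loc(1) v' r cont(2) \<phi>_partial_supp, symmetric])
  also have "\<dots> = - (LINT w|lebesgue_on (ball 0 1). \<phi> w *\<^sub>R g w)"
    using weak \<phi>_test by (simp add: has_weak_partial_def)
  also have "(LINT w|lebesgue_on (ball 0 1). \<phi> w *\<^sub>R g w) = (LINT w|lborel. \<phi> w *\<^sub>R (indicator ?K w *\<^sub>R g' w))"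
    by (rule integral_ball_eq_lborel[OF loc(2) g' r cont(1) \<phi>_supp])
  also have "\<dots> = smoothing g' x"
    by (simp add: smoothing_def dilated_convolution_def \<phi>_def)
  finally show ?thesis by simp
qed

subsection \<open>Density\<close>

text \<open>The factor \<open>rho\<close> under the root raises the exponent of the weight from
  \<open>\<beta>\<close> to \<open>\<beta> + 1\<close>, exactly the one in which gradients are
  square integrable. This function is the majorant of the commutator.\<close>

lemma L2sq_sqrt_rho_finite:
  fixes f g :: "real ^ 'n \<Rightarrow> 'a::euclidean_space"
  assumes [measurable]: "f \<in> borel_measurable borel" "g \<in> borel_measurable borel"
    and fin: "L2sq (\<beta> + 1) f < \<infinity>" "L2sq (\<beta> + 1) g < \<infinity>"
  shows "L2sq \<beta> (\<lambda>w. sqrt (rho w * ((norm (f w))\<^sup>2 + (norm (g w))\<^sup>2))) < \<infinity>"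
proof -
  have "L2sq \<beta> (\<lambda>w. sqrt (rho w * ((norm (f w))\<^sup>2 + (norm (g w))\<^sup>2))) =
    (\<integral>\<^sup>+w. ennreal ((norm (f w))\<^sup>2) * ennreal (rho w powr (\<beta> + 1)) * indicator (ball 0 1) w
      + ennreal ((norm (g w))\<^sup>2) * ennreal (rho w powr (\<beta> + 1)) * indicator (ball 0 1) w \<partial>lborel)"
    unfolding L2sq_def
  proof (intro nn_integral_cong)
    fix w :: "real ^ 'n"
    show "ennreal ((norm (sqrt (rho w * ((norm (f w))\<^sup>2 + (norm (g w))\<^sup>2))))\<^sup>2) * ennreal (rho w powr \<beta>) * indicator (ball 0 1) w
      = ennreal ((norm (f w))\<^sup>2) * ennreal (rho w powr (\<beta> + 1)) * indicator (ball 0 1) w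
      + ennreal ((norm (g w))\<^sup>2) * ennreal (rho w powr (\<beta> + 1)) * indicator (ball 0 1) w"
    proof (cases "w \<in> ball 0 1")
      case True
      then have \<rho>: "rho w > 0" by (rule rho_pos)
      then have "(norm (sqrt (rho w * ((norm (f w))\<^sup>2 + (norm (g w))\<^sup>2))))\<^sup>2 * rho w powr \<beta>
        = (norm (f w))\<^sup>2 * rho w powr (\<beta> + 1) + (norm (g w))\<^sup>2 * rho w powr (\<beta> + 1)"
        by (simp add: powr_add algebra_simps)
      then have "ennreal ((norm (sqrt (rho w * ((norm (f w))\<^sup>2 + (norm (g w))\<^sup>2))))\<^sup>2 * rho w powr \<beta>)
        = ennreal ((norm (f w))\<^sup>2 * rho w powr (\<beta> + 1) + (norm (g w))\<^sup>2 * rho w powr (\<beta> + 1))"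
        by (rule arg_cong)
      with True show ?thesis
        by (simp only: ennreal_mult ennreal_plus zero_le_power2 powr_ge_zero mult_nonneg_nonneg
            indicator_eq_1_iff mult_1_right indicator_simps)
    qed simp
  qed
  also have "\<dots> = L2sq (\<beta> + 1) f + L2sq (\<beta> + 1) g"
    unfolding L2sq_def by (rule nn_integral_add) measurable
  also have "\<dots> < \<infinity>" using fin by simp
  finally show ?thesis .
qed

text \<open>Counts the squared contributions: one for the function, d for the gradient, at most d^2
  for the pairs.\<close>

lemma WZ_norm_less:
  fixes f :: "real ^ 'n::{finite,linorder} \<Rightarrow> 'a::euclidean_space"
  assumes \<epsilon>: "\<epsilon> > 0" and \<eta>: "\<eta> \<ge> 0" "(1 + real CARD('n) + (real CARD('n))\<^sup>2) * \<eta> < \<epsilon>\<^sup>2"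
    and "(L2w_norm (\<lambda>x. rho x powr \<alpha>) f)\<^sup>2 \<le> \<eta>"
    and "\<And>i. (L2w_norm (\<lambda>x. rho x powr (\<alpha> + 1)) (weak_partial i f))\<^sup>2 \<le> \<eta>"
    and "\<And>i j. i < j \<Longrightarrow> (L2w_norm (\<lambda>x. rho x powr \<alpha>) (angular i j f))\<^sup>2 \<le> \<eta>"
  shows "WZ_norm \<alpha> f < \<epsilon>"
proof -
  have "(\<Sum>i\<in>(UNIV :: 'n set). (L2w_norm (\<lambda>x. rho x powr (\<alpha> + 1)) (weak_partial i f))\<^sup>2) \<le> real CARD('n) * \<eta>"
    using assms(5) by (intro sum_bounded_above) auto
  moreover have "(\<Sum>(i, j)\<in>{(i :: 'n, j). i < j}. (L2w_norm (\<lambda>x. rho x powr \<alpha>) (angular i j f))\<^sup>2)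
      \<le> real (card {(i :: 'n, j). i < j}) * \<eta>"
    using assms(6) by (intro sum_bounded_above) auto
  moreover have "card {(i :: 'n, j). i < j} \<le> card (UNIV :: ('n \<times> 'n) set)"
    by (intro card_mono) auto
  then have "real (card {(i :: 'n, j). i < j}) * \<eta> \<le> (real CARD('n))\<^sup>2 * \<eta>"
    using \<eta>(1) by (intro mult_right_mono) (simp_all add: power2_eq_square flip: of_nat_mult)
  ultimately show ?thesis
    unfolding WZ_norm_def using assms(4) \<epsilon> \<eta>(2)
    by (intro real_less_lsqrt) (auto simp: distrib_right)
qed

text \<open>One \<open>e\<close> has to serve finitely many error terms. The smallness conditions
  are therefore collected as eventual statements in \<open>e\<close>, before a mollifier is
  fixed.\<close>

lemma C_infinity_cball_dense_WZ:
  fixes v :: "real ^ 'n::{finite,linorder} \<Rightarrow> 'a::euclidean_space"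
  assumes \<alpha>: "\<alpha> \<ge> 0" and v: "v \<in> WZ \<alpha>" and \<epsilon>: "\<epsilon> > 0"
  shows "\<exists>u\<in>C_infinity_cball. WZ_norm \<alpha> (\<lambda>x. v x - u x) < \<epsilon>"
proof -
  let ?B = "ball (0 :: (real, 'n) vec) 1"
  have \<alpha>1: "\<alpha> + 1 \<ge> 0" using \<alpha> by simp
  define g where "g i = weak_partial i v" for i
  have weak: "has_weak_partial i v (g i)" for i
    using v weak_partial_AE_eq(1) unfolding WZ_def g_def by blast
  have loc: "locally_integrable v" "locally_integrable (g i)" for i
    using weak by (auto simp: has_weak_partial_def)
  have "v \<in> L2w (\<lambda>x. rho x powr \<alpha>)" using v by (simp add: WZ_def)
  then obtain v' where v': "v' \<in> borel_measurable borel" "AE x in lborel. x \<in> ?B \<longrightarrow> v x = v' x"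
    and v'_fin: "L2sq \<alpha> v' < \<infinity>"
    by (rule L2w_borel_representative)
  have "\<forall>i. \<exists>h. h \<in> borel_measurable borel \<and> (AE x in lborel. x \<in> ?B \<longrightarrow> g i x = h x) \<and> L2sq (\<alpha> + 1) h < \<infinity>"
  proof
    fix i
    have "g i \<in> L2w (\<lambda>x. rho x powr (\<alpha> + 1))" using v by (simp add: WZ_def g_def)
    then show "\<exists>h. h \<in> borel_measurable borel \<and> (AE x in lborel. x \<in> ?B \<longrightarrow> g i x = h x) \<and> L2sq (\<alpha> + 1) h < \<infinity>"
      by (rule L2w_borel_representative) blast
  qed
  from choice[OF this] obtain g' where
    g': "\<And>i. g' i \<in> borel_measurable borel" "\<And>i. AE x in lborel. x \<in> ?B \<longrightarrow> g i x = g' i x"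
    and g'_fin: "\<And>i. L2sq (\<alpha> + 1) (g' i) < \<infinity>"
    by blast
  note [measurable] = v'(1) g'(1)
  \<comment> \<open>Built from the representatives of the gradient, so that the algebra of the
    commutator holds pointwise; its finite norm is then inherited from \<open>angular i j v\<close>
    by equality almost everywhere.\<close>
  define a' where "a' i j x = x $ j *\<^sub>R g' i x - x $ i *\<^sub>R g' j x" for i j and x :: "(real, 'n) vec"
  have a'_meas [measurable]: "a' i j \<in> borel_measurable borel" for i j
    unfolding a'_def by measurable
  have a'_fin: "L2sq \<alpha> (a' i j) < \<infinity>" if "i < j" for i j
  proof -
    have "angular i j v \<in> L2w (\<lambda>x. rho x powr \<alpha>)" using v that by (simp add: WZ_def)
    then obtain h where h: "AE x in lborel. x \<in> ?B \<longrightarrow> angular i j v x = h x" "L2sq \<alpha> h < \<infinity>"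
      by (rule L2w_borel_representative)
    have "AE x in lborel. x \<in> ?B \<longrightarrow> a' i j x = h x"
      using h(1) g'(2)[of i] g'(2)[of j]
      by eventually_elim (auto simp: a'_def angular_def g_def)
    then show ?thesis using h(2) L2sq_AE_cong by metis
  qed
  define M where "M = 1 + real CARD('n) + (real CARD('n))\<^sup>2"
  have M: "M > 0" unfolding M_def by (intro add_pos_nonneg) auto
  \<comment> \<open>\<open>M\<close> counts the squared terms of the norm, so bounding each by
    \<open>\<eta>\<close> gives at most \<epsilon>^2 / 2 in total.\<close>
  define \<eta> where "\<eta> = \<epsilon>\<^sup>2 / (2 * M)"
  have "M * \<eta> = \<epsilon>\<^sup>2 / 2" using M by (simp add: \<eta>_def)
  then have \<eta>: "\<eta> > 0" "(1 + real CARD('n) + (real CARD('n))\<^sup>2) * \<eta> < \<epsilon>\<^sup>2"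
    using \<epsilon> M unfolding M_def[symmetric] by (simp_all add: \<eta>_def)
  let ?G = "\<lambda>i j w. sqrt (rho w * ((norm (g' i w))\<^sup>2 + (norm (g' j w))\<^sup>2))"
  have zero_fin: "L2sq \<alpha> (\<lambda>w :: (real, 'n) vec. 0 :: real) < \<infinity>" by (simp add: L2sq_def)
  have norm_fin: "L2sq (\<alpha> + 1) (\<lambda>w. norm (g' i w)) < \<infinity>" for i
    using g'_fin[of i] by (simp add: L2sq_def)
  \<comment> \<open>The last argument of \<open>small_error\<close> is 0 here because the function
    itself leaves no remainder. Below, 4 comes from (2 e)^2 \<le> 4 e, and 2 from squaring the
    two-term commutator.\<close>
  have err_v: "\<forall>\<^sub>F e in at_right 0. small_error e \<alpha> \<eta> v' (\<lambda>w. 0) 0"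
    by (intro eventually_small_error v'(1) v'_fin zero_fin \<alpha> \<eta>(1)) simp_all
  have err_g: "\<forall>\<^sub>F e in at_right 0. \<forall>i. small_error e (\<alpha> + 1) \<eta> (g' i) (\<lambda>w. norm (g' i w)) 4"
    by (intro eventually_all_finite eventually_small_error g'(1) g'_fin norm_fin \<alpha>1 \<eta>(1)
        borel_measurable_norm) simp_all
  have err_a: "\<forall>\<^sub>F e in at_right 0. \<forall>i j. i < j \<longrightarrow> small_error e \<alpha> \<eta> (a' i j) (?G i j) 2"
  proof (intro eventually_all_finite)
    fix i j
    show "\<forall>\<^sub>F e in at_right 0. i < j \<longrightarrow> small_error e \<alpha> \<eta> (a' i j) (?G i j) 2"
    proof (cases "i < j")
      case True
      have m: "?G i j \<in> borel_measurable borel" by measurable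
      have "L2sq \<alpha> (?G i j) < \<infinity>" by (intro L2sq_sqrt_rho_finite g'(1) g'_fin)
      from eventually_small_error[OF a'_meas m a'_fin[OF True] this \<alpha>, of 2 \<eta>] \<eta>(1) True
      show ?thesis by simp
    qed simp
  qed
  have "\<forall>\<^sub>F e in at_right (0 :: real). 0 < e \<and> 4 * e \<le> 1"
    unfolding eventually_at_right_field by (intro exI[of _ "1 / 4"]) auto
  from eventually_happens'[OF trivial_limit_at_right_real
      eventually_conj[OF this eventually_conj[OF err_v eventually_conj[OF err_g err_a]]]]
  obtain e where e: "0 < e" "4 * e \<le> 1"
    and errors: "small_error e \<alpha> \<eta> v' (\<lambda>w. 0) 0"
      "\<And>i. small_error e (\<alpha> + 1) \<eta> (g' i) (\<lambda>w. norm (g' i w)) 4"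
      "\<And>i j. i < j \<Longrightarrow> small_error e \<alpha> \<eta> (a' i j) (?G i j) 2"
    by blast
  obtain \<psi> :: "(real, 'n) vec \<Rightarrow> real" where \<psi>: "dilation_mollifier e \<psi>"
    using dilation_mollifier_exists[OF e] by blast
  interpret dilation_mollifier e \<psi> by (rule \<psi>)
  have r: "1 - e < 1" using e by simp
  have int_v: "integrable lborel (\<lambda>w. indicator (cball 0 (1 - e)) w *\<^sub>R v' w)"
    by (rule integrable_cball_representative[OF loc(1) v' r])
  have int_g: "integrable lborel (\<lambda>w. indicator (cball 0 (1 - e)) w *\<^sub>R g' i w)" for i
    by (rule integrable_cball_representative[OF loc(2) g' r])
  define u where "u = smoothing v'"
  have u: "u \<in> C_infinity_cball" unfolding u_def by (rule smoothing_C_infinity[OF int_v])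
  have du: "partial i u x = (1 - 2 * e) *\<^sub>R smoothing (g' i) x" if "x \<in> ?B" for i x
    unfolding u_def by (rule partial_smoothing[OF weak v' g' that])
  note S_eq = smoothing_eq[OF int_v] smoothing_eq[OF int_g]
  note S_int = integrable_kernel_scaleR[OF int_v] integrable_kernel_scaleR[OF int_g]

  have "L2sq \<alpha> (\<lambda>x. v' x - u x) < ennreal \<eta>"
  proof (rule small_errorD[OF errors(1), where R = "\<lambda>x w. 0"])
    fix x assume x: "x \<in> ?B"
    show "v' x - u x = (LINT w|lborel. kernel x w *\<^sub>R (v' x - v' w + 0))"
      using S_int(1)[OF x] integrable_kernel[of x "v' x"]
      by (simp add: u_def S_eq(1)[OF x] scaleR_diff_right integral_kernel)
  qed auto
  moreover have "L2sq \<alpha> (\<lambda>x. v x - u x) = L2sq \<alpha> (\<lambda>x. v' x - u x)"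
    using v'(2) by (intro L2sq_AE_cong) (auto elim: eventually_mono)
  ultimately have 1: "L2sq \<alpha> (\<lambda>x. v x - u x) < ennreal \<eta>" by simp

  have weak_diff: "has_weak_partial i (\<lambda>x. v x - u x) (\<lambda>x. g i x - partial i u x)" for i
    by (rule has_weak_partial_diff[OF weak C_infinity_cball_has_weak_partial[OF u]])

  have 2: "L2sq (\<alpha> + 1) (weak_partial i (\<lambda>x. v x - u x)) < ennreal \<eta>" for i
  proof -
    have "AE x in lborel. x \<in> ?B \<longrightarrow> weak_partial i (\<lambda>x. v x - u x) x = g' i x - partial i u x"
      using weak_partial_AE_eq(2)[OF weak_diff[of i], unfolded AE_lebesgue_on_ball_iff] g'(2)[of i]
      by eventually_elim auto
    then have "L2sq (\<alpha> + 1) (weak_partial i (\<lambda>x. v x - u x)) = L2sq (\<alpha> + 1) (\<lambda>x. g' i x - partial i u x)"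
      by (rule L2sq_AE_cong)
    also have "\<dots> < ennreal \<eta>"
    \<comment> \<open>The chain rule factor goes into the remainder: g(x) - (1 - 2 e) g(w) = g(x) -
      g(w) + 2 e g(w).\<close>
    proof (rule small_errorD[OF errors(2)[of i], where R = "\<lambda>x w. (2 * e) *\<^sub>R g' i w"])
      fix x assume x: "x \<in> ?B"
      show "(\<lambda>w. (2 * e) *\<^sub>R g' i w) \<in> borel_measurable borel" by measurable
      have "(LINT w|lborel. kernel x w *\<^sub>R (g' i x - g' i w + (2 * e) *\<^sub>R g' i w))
        = (LINT w|lborel. kernel x w *\<^sub>R g' i x - (1 - 2 * e) *\<^sub>R (kernel x w *\<^sub>R g' i w))"
        by (intro Bochner_Integration.integral_cong) (simp_all add: algebra_simps)
      also have "\<dots> = g' i x - (1 - 2 * e) *\<^sub>R smoothing (g' i) x"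
        using S_int(2)[OF x] integrable_kernel[of x "g' i x"]
        by (simp add: S_eq(2)[OF x] integral_kernel del: scaleR_scaleR)
      finally show "g' i x - partial i u x = (LINT w|lborel. kernel x w *\<^sub>R (g' i x - g' i w + (2 * e) *\<^sub>R g' i w))"
        by (simp add: du[OF x])
      fix w
      have "(2 * e)\<^sup>2 \<le> 4 * e" using e by (simp add: power2_eq_square)
      then show "(norm ((2 * e) *\<^sub>R g' i w))\<^sup>2 \<le> 4 * e * (norm (g' i w))\<^sup>2"
        unfolding norm_scaleR power_mult_distrib power2_abs by (rule mult_right_mono) simp
    qed
    finally show ?thesis .
  qed

  have 3: "L2sq \<alpha> (angular i j (\<lambda>x. v x - u x)) < ennreal \<eta>" if "i < j" for i j
  proof -
    have "AE x in lborel. x \<in> ?B \<longrightarrow> angular i j (\<lambda>x. v x - u x) x =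
        a' i j x - (x $ j *\<^sub>R partial i u x - x $ i *\<^sub>R partial j u x)"
      using angular_AE_eq[OF weak_diff[of i] weak_diff[of j], unfolded AE_lebesgue_on_ball_iff] g'(2)[of i] g'(2)[of j]
      by eventually_elim (auto simp: a'_def algebra_simps)
    then have "L2sq \<alpha> (angular i j (\<lambda>x. v x - u x)) =
        L2sq \<alpha> (\<lambda>x. a' i j x - (x $ j *\<^sub>R partial i u x - x $ i *\<^sub>R partial j u x))"
      by (rule L2sq_AE_cong)
    also have "\<dots> < ennreal \<eta>"
    \<comment> \<open>The rotation field of \<open>u\<close> multiplies the gradient at
      \<open>w\<close> by coordinates of the dilated point (1 - 2 e) x, whereas
      \<open>a' i j w\<close> uses those of \<open>w\<close>. The remainder collects the
      differences, which have modulus at most \<open>e\<close> on the support of the kernel.\<close>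
    proof (rule small_errorD[OF errors(3)[OF that], where R = "\<lambda>x w. ((1 - 2 * e) *\<^sub>R x - w) $ i *\<^sub>R g' j w
          + (- (((1 - 2 * e) *\<^sub>R x - w) $ j)) *\<^sub>R g' i w"])
      fix x assume x: "x \<in> ?B"
      let ?R = "\<lambda>w. ((1 - 2 * e) *\<^sub>R x - w) $ i *\<^sub>R g' j w + (- (((1 - 2 * e) *\<^sub>R x - w) $ j)) *\<^sub>R g' i w"
      have [measurable]: "(\<lambda>w. ((1 - 2 * e) *\<^sub>R x - w) $ m) \<in> borel_measurable borel" for m
        by (intro borel_measurable_continuous_onI continuous_intros)
      show "?R \<in> borel_measurable borel"
        by (intro borel_measurable_add borel_measurable_scaleR borel_measurable_uminus) measurable
      have "(LINT w|lborel. kernel x w *\<^sub>R (a' i j x - a' i j w + ?R w))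
        = (LINT w|lborel. kernel x w *\<^sub>R a' i j x - ((1 - 2 * e) * x $ j) *\<^sub>R (kernel x w *\<^sub>R g' i w)
            + ((1 - 2 * e) * x $ i) *\<^sub>R (kernel x w *\<^sub>R g' j w))"
        by (intro Bochner_Integration.integral_cong) (simp_all add: a'_def algebra_simps)
      also have "\<dots> = a' i j x - ((1 - 2 * e) * x $ j) *\<^sub>R smoothing (g' i) x + ((1 - 2 * e) * x $ i) *\<^sub>R smoothing (g' j) x"
        using S_int(2)[OF x] integrable_kernel[of x "a' i j x"]
        by (simp add: S_eq(2)[OF x] integral_kernel del: scaleR_scaleR)
      finally show "a' i j x - (x $ j *\<^sub>R partial i u x - x $ i *\<^sub>R partial j u x)
          = (LINT w|lborel. kernel x w *\<^sub>R (a' i j x - a' i j w + ?R w))"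
        by (simp add: du[OF x] mult.commute)
      fix w assume k: "kernel x w \<noteq> 0"
      have w: "w \<in> ?B" by (rule kernel_in_ball[OF x k])
      have comp: "(((1 - 2 * e) *\<^sub>R x - w) $ m)\<^sup>2 \<le> e * rho w" for m
      proof -
        have "\<bar>((1 - 2 * e) *\<^sub>R x - w) $ m\<bar> \<le> e"
          using component_le_norm_cart[of "(1 - 2 * e) *\<^sub>R x - w" m] support k by (fastforce simp: kernel_def)
        then have "(((1 - 2 * e) *\<^sub>R x - w) $ m)\<^sup>2 \<le> e\<^sup>2"
          using e by (simp add: abs_le_square_iff[symmetric])
        \<comment> \<open>One of the two factors \<open>e\<close> is traded for
          \<open>rho w\<close>, using the gap between the support of the kernel and the
          sphere.\<close>
        also have "\<dots> \<le> e * rho w"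
          unfolding power2_eq_square using e kernel_rho_ge[OF x k] by (intro mult_left_mono) auto
        finally show ?thesis .
      qed
      have "(norm (?R w))\<^sup>2 \<le> 2 * (norm (((1 - 2 * e) *\<^sub>R x - w) $ i *\<^sub>R g' j w))\<^sup>2
          + 2 * (norm ((- (((1 - 2 * e) *\<^sub>R x - w) $ j)) *\<^sub>R g' i w))\<^sup>2"
        by (rule norm_add_sq_le)
      also have "\<dots> = 2 * ((((1 - 2 * e) *\<^sub>R x - w) $ i)\<^sup>2 * (norm (g' j w))\<^sup>2)
          + 2 * ((((1 - 2 * e) *\<^sub>R x - w) $ j)\<^sup>2 * (norm (g' i w))\<^sup>2)"
        unfolding norm_scaleR power_mult_distrib power2_abs power2_minus by (rule refl)
      also have "\<dots> \<le> 2 * ((e * rho w) * (norm (g' j w))\<^sup>2) + 2 * ((e * rho w) * (norm (g' i w))\<^sup>2)"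
        by (intro add_mono mult_left_mono mult_right_mono comp) auto
      also have "\<dots> = 2 * e * (?G i j w)\<^sup>2"
        using rho_pos[OF w] by (simp add: algebra_simps)
      finally show "(norm (?R w))\<^sup>2 \<le> 2 * e * (?G i j w)\<^sup>2" .
    qed
    finally show ?thesis .
  qed

  have "WZ_norm \<alpha> (\<lambda>x. v x - u x) < \<epsilon>"
    using 1 2 3 \<eta>(1) by (intro WZ_norm_less[OF \<epsilon> less_imp_le[OF \<eta>(1)] \<eta>(2)] L2w_norm_sq_le less_imp_le)
  with u show ?thesis by blast
qed

text \<open>Density comprises the inclusion in the space as well as approximation in norm, hence the
  conjunction.\<close>

theorem corollaryA3:
  fixes \<alpha> :: real
  assumes "\<alpha> \<ge> 0"
  shows "(C_infinity_cball ::
            (real ^ 'n::{finite,linorder} \<Rightarrow> 'a::{real_normed_field,euclidean_space}) set) \<subseteq> WZ \<alpha>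
       \<and> (\<forall>v \<in> (WZ \<alpha> :: (real ^ 'n::{finite,linorder} \<Rightarrow> 'a::{real_normed_field,euclidean_space}) set).
            \<forall>\<epsilon>>0. \<exists>u \<in> C_infinity_cball. WZ_norm \<alpha> (\<lambda>x. v x - u x) < \<epsilon>)"
  using C_infinity_cball_imp_WZ[OF assms] C_infinity_cball_dense_WZ[OF assms] by blast

end
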